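(* Let $L,N\in\mathbb{N}$, let $T_2,\ldots,T_N$ be invertible complex $L\times L$ matrices and $V_1,\ldots,V_N$ self-adjoint complex $L\times L$ matrices, and put $T_1=T_{N+1}=\mathbf{1}$. For $z\in\mathbb{C}$ let $$\mathcal{T}^z_n=\begin{pmatrix}(z\mathbf{1}-V_n)T_n^{-1} & -T_n^*\\ T_n^{-1} & \mathbf{0}\end{pmatrix},\quad n=1,\ldots,N,\qquad \mathcal{T}^z_N\cdots\mathcal{T}^z_1=\begin{pmatrix}A^z_N & B^z_N\\ C^z_N & D^z_N\end{pmatrix},$$ with $L\times L$ blocks $A^z_N,B^z_N,C^z_N,D^z_N$. For a unitary $U\in\mathrm{U}(L)$ without eigenvalue $-1$, let $Z$ be the unique self-adjoint matrix with $U=(-Z-\imath\mathbf{1})(-Z+\imath\mathbf{1})^{-1}$, let $H^N_{\mathbf{0},Z}$ be the $NL\times NL$ block tridiagonal matrix with diagonal blocks $V_1,V_2,\ldots,V_{N-1},V_N-Z$, superdiagonal blocks $T_2,\ldots,T_N$ and subdiagonal blocks $T_2^*,\ldots,T_N^*$, and let $G^z_N(\mathbf{1},U)=\pi_1^*(H^N_{\mathbf{0},Z}-z\mathbf{1})^{-1}\pi_1$, where $\pi_1:\mathbb{C}^L\to\mathbb{C}^{NL}$ is the isometric embedding onto the first block. Let $dU$ be the normalized Haar measure on $\mathrm{U}(L)$. Then for $\Im m(z)>0$, $$\int dU\,G^z_N(\mathbf{1},U)=\left[A^z_N+\imath C^z_N\right]^{-1}\left[B^z_N+\imath D^z_N\right]=\left[(B^{\overline{z}}_N)^*+\imath(D^{\overline{z}}_N)^*\right]\left[(A^{\overline{z}}_N)^*+\imath(C^{\overline{z}}_N)^*\right]^{-1}.$$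 Moreover, for $E\in\mathbb{R}$, with $\Im m(X)=\frac{1}{2\imath}(X-X^* )$ for any square matrix $X$ and the limit taken with $\Re e(z)=E$, $$\lim_{\Im m(z)\downarrow 0}\int dU\,\Im m\big(G^z_N(\mathbf{1},U)\big)=\left[(A^E_N)^*A^E_N+(C^E_N)^*C^E_N\right]^{-1}.$$
   Context: The set of unitaries with eigenvalue $-1$ has Haar measure zero, so $G^z_N(\mathbf{1},U)$ is defined for $dU$-almost every $U$; $\mathbf{1}$ in the first argument indicates the Dirichlet left boundary condition (the first diagonal block is $V_1$ unmodified). *)

theory Defs
  imports "HOL-Analysis.Analysis" "HOL-Probability.Probability"
begin

text \<open>The size L of the blocks is the cardinality of the finite index type 'l.
  L x L complex matrices are elements of complex^'l^'l.\<close>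

definition cadj :: "complex^'l^'l \<Rightarrow> complex^'l^'l" where
  "cadj M = (\<chi> i j. cnj (M $ j $ i))"

definition self_adjoint_mat :: "complex^'l^'l \<Rightarrow> bool" where
  "self_adjoint_mat M \<longleftrightarrow> cadj M = M"

definition unitary_mat :: "complex^'l^'l \<Rightarrow> bool" where
  "unitary_mat U \<longleftrightarrow> cadj U ** U = mat 1 \<and> U ** cadj U = mat 1"

definition mat_Im :: "complex^'l^'l \<Rightarrow> complex^'l^'l" where
  "mat_Im X = (\<chi> i j. (X $ i $ j - cnj (X $ j $ i)) / (2 * \<i>))"

definition haar_unitary :: "(complex^'l^'l) measure" where
  "haar_unitary = (THE \<mu>. prob_space \<mu> \<and> sets \<mu> = sets borel \<and>
      emeasure \<mu> {U. \<not> unitary_mat U} = 0 \<and>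
      (\<forall>W. unitary_mat W \<longrightarrow> distr \<mu> borel (\<lambda>U. W ** U) = \<mu>))"

definition cayley_Z :: "complex^'l^'l \<Rightarrow> complex^'l^'l" where
  "cayley_Z U = (THE Z. self_adjoint_mat Z \<and> U = (- Z - mat \<i>) ** matrix_inv (- Z + mat \<i>))"

definition Tfull :: "nat \<Rightarrow> (nat \<Rightarrow> complex^'l^'l) \<Rightarrow> nat \<Rightarrow> complex^'l^'l" where
  "Tfull N T n = (if n = 1 \<or> n = N + 1 then mat 1 else T n)"

definition transfer ::
  "nat \<Rightarrow> (nat \<Rightarrow> complex^'l^'l) \<Rightarrow> (nat \<Rightarrow> complex^'l^'l) \<Rightarrow> complex \<Rightarrow> nat
     \<Rightarrow> complex^('l + 'l)^('l + 'l)" where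
  "transfer N T V z n =
     (let Tn = Tfull N T n;
          M11 = (mat z - V n) ** matrix_inv Tn;
          M12 = - cadj Tn;
          M21 = matrix_inv Tn
      in (\<chi> i j. case (i, j) of
            (Inl a, Inl b) \<Rightarrow> M11 $ a $ b
          | (Inl a, Inr b) \<Rightarrow> M12 $ a $ b
          | (Inr a, Inl b) \<Rightarrow> M21 $ a $ b
          | (Inr a, Inr b) \<Rightarrow> 0))"

fun transfer_prod ::
  "nat \<Rightarrow> (nat \<Rightarrow> complex^'l^'l) \<Rightarrow> (nat \<Rightarrow> complex^'l^'l) \<Rightarrow> complex \<Rightarrow> nat
     \<Rightarrow> complex^('l + 'l)^('l + 'l)" where
  "transfer_prod N T V z 0 = mat 1"
| "transfer_prod N T V z (Suc k) = transfer N T V z (Suc k) ** transfer_prod N T V z k"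

definition blk11 :: "'a^('l + 'l)^('l + 'l) \<Rightarrow> 'a^'l^'l" where
  "blk11 M = (\<chi> a b. M $ Inl a $ Inl b)"
definition blk12 :: "'a^('l + 'l)^('l + 'l) \<Rightarrow> 'a^'l^'l" where
  "blk12 M = (\<chi> a b. M $ Inl a $ Inr b)"
definition blk21 :: "'a^('l + 'l)^('l + 'l) \<Rightarrow> 'a^'l^'l" where
  "blk21 M = (\<chi> a b. M $ Inr a $ Inl b)"
definition blk22 :: "'a^('l + 'l)^('l + 'l) \<Rightarrow> 'a^'l^'l" where
  "blk22 M = (\<chi> a b. M $ Inr a $ Inr b)"

definition A_N where "A_N N T V z = blk11 (transfer_prod N T V z N)"
definition B_N where "B_N N T V z = blk12 (transfer_prod N T V z N)"
definition C_N where "C_N N T V z = blk21 (transfer_prod N T V z N)"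
definition D_N where "D_N N T V z = blk22 (transfer_prod N T V z N)"

text \<open>NL x NL matrices are represented as N x N block matrices: functions
  nat \<Rightarrow> nat \<Rightarrow> complex^'l^'l whose blocks (n,m) with n,m in {1..N} are the entries
  (blocks outside {1..N}^2 are irrelevant / zero).\<close>

definition block_mult :: "nat \<Rightarrow> (nat \<Rightarrow> nat \<Rightarrow> complex^'l^'l) \<Rightarrow> (nat \<Rightarrow> nat \<Rightarrow> complex^'l^'l)
     \<Rightarrow> nat \<Rightarrow> nat \<Rightarrow> complex^'l^'l" where
  "block_mult N P Q n m = (\<Sum>k\<in>{1..N}. P n k ** Q k m)"

definition block_id :: "nat \<Rightarrow> nat \<Rightarrow> complex^'l^'l" where
  "block_id n m = (if n = m then mat 1 else 0)"

definition H_block :: "nat \<Rightarrow> (nat \<Rightarrow> complex^'l^'l) \<Rightarrow> (nat \<Rightarrow> complex^'l^'l) \<Rightarrow> complex^'l^'l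
     \<Rightarrow> nat \<Rightarrow> nat \<Rightarrow> complex^'l^'l" where
  "H_block N T V Z n m =
     (if n \<notin> {1..N} \<or> m \<notin> {1..N} then 0
      else if n = m then (if n = N then V N - Z else V n)
      else if m = n + 1 then T m
      else if n = m + 1 then cadj (T n)
      else 0)"

definition block_inv :: "nat \<Rightarrow> (nat \<Rightarrow> nat \<Rightarrow> complex^'l^'l) \<Rightarrow> nat \<Rightarrow> nat \<Rightarrow> complex^'l^'l" where
  "block_inv N P = (THE R. (\<forall>n m. n \<notin> {1..N} \<or> m \<notin> {1..N} \<longrightarrow> R n m = 0) \<and>
      (\<forall>n\<in>{1..N}. \<forall>m\<in>{1..N}. block_mult N P R n m = block_id n m \<and> block_mult N R P n m = block_id n m))"

definition G_N :: "nat \<Rightarrow> (nat \<Rightarrow> complex^'l^'l) \<Rightarrow> (nat \<Rightarrow> complex^'l^'l) \<Rightarrow> complex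
     \<Rightarrow> complex^'l^'l \<Rightarrow> complex^'l^'l" where
  "G_N N T V z U =
     block_inv N (\<lambda>n m. H_block N T V (cayley_Z U) n m - (if n = m then mat z else 0)) 1 1"

end

theory Submission
  imports Defs
begin

text \<open>
  Solving the three-term recursion from the left and imposing the right boundary condition gives
  \<open>(A + Z C) G = B + Z D\<close>. Inserting the Cayley parametrization of \<open>Z\<close> turns this into
  \<open>(P - W Q) G = R - W S\<close> with \<open>W = U\<^sup>*\<close>, \<open>P = A + i C\<close>, \<open>Q = A - i C\<close>, \<open>R = B + i D\<close>,
  \<open>S = B - i D\<close>. The Wronskian identity makes \<open>K = Q P\<inverse>\<close> a strict contraction for \<open>Im z > 0\<close>, so
  \<open>P G - R\<close> is a norm convergent series of monomials of positive degree in \<open>W\<close>. These average to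
  zero because the Haar measure is invariant under phases, and the mean of \<open>G\<close> is \<open>P\<inverse> R\<close>. The
  second expression and the limit follow from the symplectic relations for the transfer matrices.

  The Haar measure itself is the image of normalized Lebesgue measure near the unitary group under
  a polar factor that commutes with left multiplication by unitaries.
\<close>

section \<open>Complex matrices with the Frobenius inner product\<close>

text \<open>\<open>haar_unitary\<close>, \<open>cayley_Z\<close> and \<open>block_inv\<close> are
  definite descriptions, so each says nothing until existence and uniqueness are proved; much of the
  work before the averaging goes into this. Convergence is measured in the Frobenius norm on whole
  matrices: left multiplication by a unitary is an isometry for it, and injectivity and contraction
  are tested on matrices X in place of vectors. The average is computed only for Im z > 0. At real z
  the Wronskian vanishes, K becomes an isometry and the series gives no bound, so the limit is taken
  in the closed formula, whose denominator P stays invertible on the real axis.\<close>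

definition cscale :: "complex \<Rightarrow> complex^'l^'l \<Rightarrow> complex^'l^'l" where
  "cscale c X = (\<chi> i j. c * X $ i $ j)"

lemma cscale_nth [simp]: "cscale c X $ i $ j = c * X $ i $ j"
  by (simp add: cscale_def)

lemma mat_eq_cscale: "mat c = cscale c (mat 1)"
  by (simp add: vec_eq_iff mat_def)

lemma mat_mult_eq_cscale: "mat c ** X = cscale c X"
  by (simp add: vec_eq_iff mat_def matrix_matrix_mult_def if_distrib if_distribR cong: if_cong)

lemma cscale_mult_left: "cscale c X ** Y = cscale c (X ** Y)"
  by (simp add: vec_eq_iff matrix_matrix_mult_def sum_distrib_left mult.assoc)

lemma cscale_mult_right: "X ** cscale c Y = cscale c (X ** Y)"
  by (simp add: vec_eq_iff matrix_matrix_mult_def sum_distrib_left ac_simps)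

lemma cscale_add: "cscale c (X + Y) = cscale c X + cscale c Y"
  and cscale_diff: "cscale c (X - Y) = cscale c X - cscale c Y"
  and cscale_minus: "cscale c (- X) = - cscale c X"
  and cscale_zero: "cscale c 0 = 0"
  by (simp_all add: vec_eq_iff algebra_simps)

lemma cscale_cscale: "cscale c (cscale d X) = cscale (c * d) X"
  by (simp add: vec_eq_iff)

lemma cscale_one: "cscale 1 X = X"
  and cscale_neg: "cscale (- c) X = - cscale c X"
  by (simp_all add: vec_eq_iff)

lemma matrix_mult_minus_left: "(- X) ** (Y :: complex^'l^'l) = - (X ** Y)"
  and matrix_mult_minus_right: "X ** (- Y) = - (X ** (Y :: complex^'l^'l))"
  by (simp_all add: vec_eq_iff matrix_matrix_mult_def sum_negf)

lemma matrix_diff_ldistrib: "X ** (Y - Z) = X ** Y - X ** (Z :: complex^'l^'l)"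
  and matrix_diff_rdistrib: "(Y - Z) ** X = Y ** X - Z ** (X :: complex^'l^'l)"
  and matrix_plus_rdistrib: "(Y + Z) ** X = Y ** X + Z ** (X :: complex^'l^'l)"
  by (simp_all add: vec_eq_iff matrix_matrix_mult_def algebra_simps sum_subtractf sum.distrib)

lemma matrix_scaleR_left: "(r *\<^sub>R X) ** Y = r *\<^sub>R (X ** (Y :: complex^'l^'l))"
  and matrix_scaleR_right: "X ** (r *\<^sub>R Y) = r *\<^sub>R (X ** (Y :: complex^'l^'l))"
  by (simp_all add: vec_eq_iff matrix_matrix_mult_def scaleR_sum_right)

lemma matrix_sum_ldistrib:
  fixes X :: "complex^'l^'l"
  shows "X ** (\<Sum>k\<in>I. f k) = (\<Sum>k\<in>I. X ** (f k :: complex^'l^'l))"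
  by (induction I rule: infinite_finite_induct) (simp_all add: matrix_add_ldistrib)

lemma matrix_sum_rdistrib:
  fixes f :: "'i \<Rightarrow> complex^'l^'l"
  shows "(\<Sum>k\<in>I. f k) ** X = (\<Sum>k\<in>I. f k ** (X :: complex^'l^'l))"
  by (induction I rule: infinite_finite_induct) (simp_all add: matrix_plus_rdistrib)

lemma cadj_nth [simp]: "cadj X $ i $ j = cnj (X $ j $ i)"
  by (simp add: cadj_def)

lemma cadj_cadj [simp]: "cadj (cadj X) = X"
  and cadj_zero [simp]: "cadj 0 = 0"
  and cadj_one [simp]: "cadj (mat 1) = mat 1"
  and cadj_mat: "cadj (mat c) = mat (cnj c)"
  by (simp_all add: vec_eq_iff mat_def)

lemma cadj_mult: "cadj (X ** Y) = cadj Y ** cadj X"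
  by (simp add: vec_eq_iff matrix_matrix_mult_def mult.commute)

lemma cadj_add: "cadj (X + Y) = cadj X + cadj Y"
  and cadj_diff: "cadj (X - Y) = cadj X - cadj Y"
  and cadj_minus: "cadj (- X) = - cadj X"
  and cadj_cscale: "cadj (cscale c X) = cscale (cnj c) (cadj X)"
  and cadj_scaleR: "cadj (r *\<^sub>R X) = r *\<^sub>R cadj X"
  by (simp_all add: vec_eq_iff)

lemma cadj_sum: "cadj (\<Sum>k\<in>I. f k) = (\<Sum>k\<in>I. cadj (f k))"
  by (induction I rule: infinite_finite_induct) (simp_all add: cadj_add)

text \<open>Normal form for noncommutative polynomials in matrices: products are expanded and nested
  to the right, scalars stand in front. What remains of an identity is a comparison of sums.\<close>

lemmas matrix_ring_simps =
  matrix_add_ldistrib matrix_plus_rdistrib matrix_diff_ldistrib matrix_diff_rdistrib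
  matrix_mult_minus_left matrix_mult_minus_right matrix_mul_assoc[symmetric]
  cscale_mult_left cscale_mult_right cscale_add cscale_diff cscale_minus cscale_zero
  cscale_cscale cscale_one cscale_neg mat_mult_eq_cscale matrix_scaleR_left matrix_scaleR_right

lemmas cadj_simps =
  cadj_mult cadj_add cadj_diff cadj_minus cadj_cscale cadj_scaleR

text \<open>The inner product of \<open>complex^'l^'l\<close> is the real part of the trace of X^*
  Y, so the adjoint of left multiplication by A is left multiplication by
  \<open>cadj A\<close>.\<close>

lemma inner_matrix_mult_left:
  "inner (A ** X) Y = inner X (cadj A ** (Y :: complex^'l^'l))"
proof -
  have c: "inner (a * x) y = inner x (cnj a * y)" for a x y :: complex
    by (simp add: inner_complex_def algebra_simps)
  have "inner (A ** X) Y = (\<Sum>i\<in>UNIV. \<Sum>j\<in>UNIV. \<Sum>k\<in>UNIV. inner (X $ k $ j) (cnj (A $ i $ k) * Y $ i $ j))"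
    by (simp add: inner_vec_def matrix_matrix_mult_def inner_sum_left c)
  also have "\<dots> = (\<Sum>i\<in>UNIV. \<Sum>k\<in>UNIV. \<Sum>j\<in>UNIV. inner (X $ k $ j) (cnj (A $ i $ k) * Y $ i $ j))"
    by (rule sum.cong[OF refl], rule sum.swap)
  also have "\<dots> = (\<Sum>k\<in>UNIV. \<Sum>i\<in>UNIV. \<Sum>j\<in>UNIV. inner (X $ k $ j) (cnj (A $ i $ k) * Y $ i $ j))"
    by (rule sum.swap)
  also have "\<dots> = (\<Sum>k\<in>UNIV. \<Sum>j\<in>UNIV. \<Sum>i\<in>UNIV. inner (X $ k $ j) (cnj (A $ i $ k) * Y $ i $ j))"
    by (rule sum.cong[OF refl], rule sum.swap)
  also have "\<dots> = inner X (cadj A ** Y)"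
    by (simp add: inner_vec_def matrix_matrix_mult_def inner_sum_right)
  finally show ?thesis .
qed

lemma inner_cscale_left: "inner (cscale c X) Y = inner X (cscale (cnj c) (Y :: complex^'l^'l))"
  by (simp add: inner_vec_def inner_complex_def algebra_simps)

lemma inner_cscale_i:
  "inner (cscale \<i> X) (cscale \<i> Y) = inner X (Y :: complex^'l^'l)"
  by (simp add: inner_cscale_left cscale_cscale cscale_one)

lemma inner_cscale_i_left: "inner (cscale \<i> X) Y = - inner X (cscale \<i> (Y :: complex^'l^'l))"
  by (simp add: inner_cscale_left cscale_neg)

lemma norm_matrix_sq: "(norm (X :: complex^'l^'l))\<^sup>2 = inner (mat 1) (cadj X ** X)"
  using inner_matrix_mult_left[of X "mat 1" X] by (simp add: power2_norm_eq_inner)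

lemma norm_matrix_mult_le:
  fixes X Y :: "complex^'l^'l"
  shows "norm (X ** Y) \<le> norm X * norm Y"
proof (rule power2_le_imp_le)
  have sq: "(norm (Z :: complex^'l^'l))\<^sup>2 = (\<Sum>i\<in>UNIV. \<Sum>j\<in>UNIV. (cmod (Z $ i $ j))\<^sup>2)" for Z
    by (simp add: norm_vec_def L2_set_def sum_nonneg)
  have "(cmod ((X ** Y) $ i $ j))\<^sup>2 \<le> (\<Sum>k\<in>UNIV. (cmod (X $ i $ k))\<^sup>2) * (\<Sum>k\<in>UNIV. (cmod (Y $ k $ j))\<^sup>2)" for i j
  proof -
    have "cmod ((X ** Y) $ i $ j) \<le> (\<Sum>k\<in>UNIV. cmod (X $ i $ k) * cmod (Y $ k $ j))"
      by (simp add: matrix_matrix_mult_def sum_norm_le norm_mult)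
    then have "(cmod ((X ** Y) $ i $ j))\<^sup>2 \<le> (\<Sum>k\<in>UNIV. cmod (X $ i $ k) * cmod (Y $ k $ j))\<^sup>2"
      by (simp add: power_mono)
    also have "\<dots> \<le> (\<Sum>k\<in>UNIV. (cmod (X $ i $ k))\<^sup>2) * (\<Sum>k\<in>UNIV. (cmod (Y $ k $ j))\<^sup>2)"
      by (rule Cauchy_Schwarz_ineq_sum)
    finally show ?thesis .
  qed
  then have "(\<Sum>i\<in>UNIV. \<Sum>j\<in>UNIV. (cmod ((X ** Y) $ i $ j))\<^sup>2) \<le> (\<Sum>i\<in>UNIV. \<Sum>j\<in>UNIV. (\<Sum>k\<in>UNIV. (cmod (X $ i $ k))\<^sup>2) * (\<Sum>k\<in>UNIV. (cmod (Y $ k $ j))\<^sup>2))"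
    by (intro sum_mono)
  also have "\<dots> = (\<Sum>i\<in>UNIV. \<Sum>k\<in>UNIV. (cmod (X $ i $ k))\<^sup>2) * (\<Sum>j\<in>UNIV. \<Sum>k\<in>UNIV. (cmod (Y $ k $ j))\<^sup>2)"
    by (simp add: sum_product)
  also have "(\<Sum>j\<in>UNIV. \<Sum>k\<in>UNIV. (cmod (Y $ k $ j))\<^sup>2) = (\<Sum>k\<in>UNIV. \<Sum>j\<in>UNIV. (cmod (Y $ k $ j))\<^sup>2)"
    by (rule sum.swap)
  finally show "(norm (X ** Y))\<^sup>2 \<le> (norm X * norm Y)\<^sup>2"
    unfolding power_mult_distrib sq[of X] sq[of Y] sq[of "X ** Y"] .
qed auto

lemma bounded_bilinear_matrix_mult:
  "bounded_bilinear ((**) :: complex^'l^'l \<Rightarrow> complex^'l^'l \<Rightarrow> complex^'l^'l)"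
proof
  show "\<exists>K. \<forall>(X :: complex^'l^'l) (Y :: complex^'l^'l). norm (X ** Y) \<le> norm X * norm Y * K"
    by (intro exI[of _ 1]) (simp add: norm_matrix_mult_le)
qed (simp_all add: matrix_ring_simps)

lemmas tendsto_matrix_mult [tendsto_intros] =
    bounded_bilinear.tendsto[OF bounded_bilinear_matrix_mult]
  and continuous_on_matrix_mult [continuous_intros] =
    bounded_bilinear.continuous_on[OF bounded_bilinear_matrix_mult]

lemma bounded_linear_cadj: "bounded_linear (cadj :: complex^'l^'l \<Rightarrow> _)"
  by (intro linear_conv_bounded_linear[THEN iffD1] linearI) (simp_all add: cadj_simps)

lemma bounded_linear_cscale: "bounded_linear (cscale c :: complex^'l^'l \<Rightarrow> _)"
  by (intro linear_conv_bounded_linear[THEN iffD1] linearI) (simp_all add: vec_eq_iff algebra_simps)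

lemmas tendsto_cadj [tendsto_intros] = bounded_linear.tendsto[OF bounded_linear_cadj]
  and continuous_on_cadj [continuous_intros] = bounded_linear.continuous_on[OF bounded_linear_cadj]
  and continuous_on_cscale [continuous_intros] = bounded_linear.continuous_on[OF bounded_linear_cscale]

section \<open>Inverse matrices and their continuity\<close>

lemma
  fixes A :: "complex^'l^'l"
  shows matrix_inv_left: "invertible A \<Longrightarrow> matrix_inv A ** A = (mat 1 :: complex^'l^'l)"
  and matrix_inv_right: "invertible A \<Longrightarrow> A ** matrix_inv A = (mat 1 :: complex^'l^'l)"
  unfolding invertible_def matrix_inv_def by (rule someI2_ex, assumption, simp)+

lemma matrix_inv_unique:
  fixes A :: "complex^'l^'l"
  assumes "A ** B = (mat 1 :: complex^'l^'l)"
  shows "invertible A" "matrix_inv A = B"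
proof -
  show inv: "invertible A"
    using assms invertible_right_inverse by blast
  have "matrix_inv A ** (A ** B) = B"
    by (simp add: matrix_mul_assoc matrix_inv_left[OF inv])
  then show "matrix_inv A = B"
    by (simp add: assms)
qed

lemma matrix_eq_inv_mult_iff:
  fixes A :: "complex^'l^'l"
  assumes "invertible A"
  shows "A ** X = Y \<longleftrightarrow> X = matrix_inv A ** (Y :: complex^'l^'l)"
  using matrix_inv_left[OF assms] matrix_inv_right[OF assms]
  by (metis matrix_mul_assoc matrix_mul_lid)

lemma matrix_mult_left_cancel:
  fixes A :: "complex^'l^'l"
  assumes "invertible A"
  shows "A ** X = A ** Y \<longleftrightarrow> X = (Y :: complex^'l^'l)"
  using matrix_inv_left[OF assms] by (metis matrix_mul_assoc matrix_mul_lid)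

lemma matrix_mult_right_cancel:
  fixes A :: "complex^'l^'l"
  assumes "invertible A"
  shows "X ** A = Y ** A \<longleftrightarrow> X = (Y :: complex^'l^'l)"
  using matrix_inv_right[OF assms] by (metis matrix_mul_assoc matrix_mul_rid)

text \<open>Left multiplication by A is a real-linear endomorphism of a finite-dimensional space;
  being injective it is surjective, and a preimage of the identity is a right inverse.\<close>

lemma invertible_if_injective:
  fixes A :: "complex^'l^'l"
  assumes "\<And>X :: complex^'l^'l. A ** X = 0 \<Longrightarrow> X = 0"
  shows "invertible A"
proof -
  have lin: "linear (\<lambda>X :: complex^'l^'l. A ** X)"
    by (intro linearI) (simp_all add: matrix_ring_simps)
  then have "inj (\<lambda>X :: complex^'l^'l. A ** X)"
    using assms by (simp add: linear_injective_0)
  then have "surj (\<lambda>X :: complex^'l^'l. A ** X)"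
    using lin by (simp add: linear_injective_imp_surjective)
  then obtain B where "A ** B = mat 1"
    by (metis surjD)
  then show ?thesis
    by (rule matrix_inv_unique)
qed

lemma invertible_cadj:
  fixes A :: "complex^'l^'l"
  assumes "invertible A"
  shows "invertible (cadj A)"
  using assms by (metis cadj_mult cadj_one matrix_inv_left matrix_inv_unique(1))

lemma continuous_on_det: "continuous_on S (det :: complex^'l^'l \<Rightarrow> complex)"
  unfolding det_def by (intro continuous_intros)

text \<open>Cramer's rule for each column. It exhibits the entries of the inverse as quotients of
  polynomials, hence as continuous functions.\<close>

lemma matrix_inv_nth:
  fixes A :: "complex^'l^'l"
  assumes "invertible A"
  shows "matrix_inv A $ k $ l = det (\<chi> i j. if j = k then mat 1 $ i $ l else A $ i $ j) / det A"
proof -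
  have "A *v column l (matrix_inv A) = column l (mat 1 :: complex^'l^'l)"
    using matrix_inv_right[OF assms]
    by (simp add: vec_eq_iff matrix_vector_mult_def matrix_matrix_mult_def column_def)
  then have col: "column l (matrix_inv A)
      = (\<chi> k. det (\<chi> i j. if j = k then column l (mat 1 :: complex^'l^'l) $ i else A $ i $ j) / det A)"
    using cramer[of A] assms by (simp add: invertible_det_nz)
  have "matrix_inv A $ k $ l = column l (matrix_inv A) $ k"
    by (simp add: column_def)
  also have "\<dots> = det (\<chi> i j. if j = k then column l (mat 1 :: complex^'l^'l) $ i else A $ i $ j) / det A"
    unfolding col by simp
  also have "(\<chi> i j. if j = k then column l (mat 1 :: complex^'l^'l) $ i else A $ i $ j)
      = (\<chi> i j. if j = k then mat 1 $ i $ l else A $ i $ j)"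
    by (simp add: vec_eq_iff column_def)
  finally show ?thesis .
qed

lemma continuous_on_matrix_inv:
  "continuous_on {A :: complex^'l^'l. invertible A} matrix_inv"
proof -
  have "continuous_on {A :: complex^'l^'l. invertible A} (\<lambda>A. \<chi> k l. matrix_inv A $ k $ l)"
  proof (intro continuous_on_vec_lambda)
    fix k l
    have "continuous_on {A :: complex^'l^'l. invertible A}
        (\<lambda>A. det (\<chi> i j. if j = k then mat 1 $ i $ l else A $ i $ j) / det A)"
    proof (intro continuous_on_divide)
      show "continuous_on {A :: complex^'l^'l. invertible A}
          (\<lambda>A. det (\<chi> i j. if j = k then mat 1 $ i $ l else A $ i $ j))"
      proof (rule continuous_on_compose2[OF continuous_on_det[of UNIV]])
        show "continuous_on {A :: complex^'l^'l. invertible A}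
            (\<lambda>A. \<chi> i j. if j = k then mat 1 $ i $ l else A $ i $ j)"
        proof (intro continuous_on_vec_lambda)
          fix i j
          show "continuous_on {A :: complex^'l^'l. invertible A}
            (\<lambda>A. if j = k then mat 1 $ i $ l else A $ i $ j)"
            by (cases "j = k") (auto intro!: continuous_intros)
        qed
      qed auto
    qed (auto simp: invertible_det_nz intro: continuous_on_det)
    then show "continuous_on {A :: complex^'l^'l. invertible A} (\<lambda>A. matrix_inv A $ k $ l)"
      by (rule continuous_on_eq) (simp add: matrix_inv_nth)
  qed
  then show ?thesis
    by simp
qed

lemma open_invertible: "open {A :: complex^'l^'l. invertible A}"
proof -
  have "{A :: complex^'l^'l. invertible A} = det -` (- {0})"
    by (auto simp: invertible_det_nz)
  moreover have "open (det -` (- {0}) :: (complex^'l^'l) set)"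
    by (intro open_vimage continuous_on_det) auto
  ultimately show ?thesis
    by simp
qed

lemma tendsto_matrix_inv:
  assumes "(f \<longlongrightarrow> A) F" and "invertible (A :: complex^'l^'l)"
  shows "((\<lambda>x. matrix_inv (f x)) \<longlongrightarrow> matrix_inv A) F"
proof -
  have "isCont matrix_inv A"
    using continuous_on_eq_continuous_at[OF open_invertible, of matrix_inv]
      continuous_on_matrix_inv assms(2) by blast
  then show ?thesis
    using assms(1) isCont_tendsto_compose by blast
qed

section \<open>Unitary matrices and the Cayley parametrization\<close>

lemma unitary_matD: "unitary_mat U \<Longrightarrow> cadj U ** U = mat 1" "unitary_mat U \<Longrightarrow> U ** cadj U = mat 1"
  by (simp_all add: unitary_mat_def)

lemma unitary_matI: "cadj U ** U = mat 1 \<Longrightarrow> unitary_mat U"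
  by (simp add: unitary_mat_def matrix_left_right_inverse)

lemma unitary_cadj: "unitary_mat U \<Longrightarrow> unitary_mat (cadj U)"
  by (auto simp: unitary_mat_def)

lemma unitary_cancel:
  fixes U X :: "complex^'l^'l"
  assumes "unitary_mat U"
  shows "cadj U ** (U ** X) = X" "U ** (cadj U ** X) = X"
  using assms by (simp_all add: matrix_mul_assoc unitary_mat_def)

lemma unitary_cscale: "unitary_mat U \<Longrightarrow> cmod c = 1 \<Longrightarrow> unitary_mat (cscale c U)"
proof -
  assume U: "unitary_mat U" and c: "cmod c = 1"
  have "c * cnj c = 1"
    using c by (metis complex_norm_square of_real_1 power_one)
  then show ?thesis
    using unitary_matD(1)[OF U] by (intro unitary_matI) (simp add: cadj_cscale matrix_ring_simps)
qed

lemma norm_unitary_mult: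
  fixes U X :: "complex^'l^'l"
  shows "unitary_mat U \<Longrightarrow> norm (U ** X) = norm X"
  by (simp add: norm_eq_sqrt_inner inner_matrix_mult_left unitary_cancel)

lemma closed_unitary: "closed {U :: complex^'l^'l. unitary_mat U}"
proof -
  have "{U :: complex^'l^'l. unitary_mat U} = {U. cadj U ** U = mat 1}"
    using unitary_matI unitary_matD by auto
  moreover have "closed {U :: complex^'l^'l. cadj U ** U = mat 1}"
    by (intro closed_Collect_eq continuous_intros)
  ultimately show ?thesis
    by simp
qed

lemma borel_unitary [measurable]: "{U :: complex^'l^'l. unitary_mat U} \<in> sets borel"
  by (intro borel_closed closed_unitary)

text \<open>A kernel element X satisfies Z X = i X. Moving Z across the inner product of Z X with i
  X shows that the squared norm of X equals its own negative.\<close>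

lemma invertible_self_adjoint_minus_i:
  fixes Z :: "complex^'l^'l"
  assumes "self_adjoint_mat Z"
  shows "invertible (- Z + mat \<i>)"
proof (rule invertible_if_injective)
  fix X :: "complex^'l^'l" assume "(- Z + mat \<i>) ** X = 0"
  then have ZX: "Z ** X = cscale \<i> X"
    by (simp add: matrix_ring_simps)
  have "inner (Z ** X) (cscale \<i> X) = inner X (cscale \<i> (Z ** X))"
    using assms by (simp add: inner_matrix_mult_left self_adjoint_mat_def matrix_ring_simps)
  then have "inner X X = - inner X X"
    unfolding ZX by (simp add: inner_cscale_i matrix_ring_simps)
  then show "X = 0"
    by simp
qed

text \<open>The form free of inverses, which determines Z as soon as \<open>U - mat 1\<close> is
  invertible. The transform sends Z = 0 to U = -1 and tends to U = 1 for large Z, so the eigenvalue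
  excluded by this formula is 1.\<close>

lemma cayley_relation_iff:
  assumes Z: "self_adjoint_mat Z"
  shows "U = (- Z - mat \<i>) ** matrix_inv (- Z + mat \<i>) \<longleftrightarrow>
    (U - mat 1) ** Z = cscale \<i> (U + mat 1)"
proof -
  let ?Y = "- Z + mat \<i>"
  have Y: "invertible ?Y"
    by (rule invertible_self_adjoint_minus_i[OF Z])
  have "U = (- Z - mat \<i>) ** matrix_inv ?Y \<longleftrightarrow> U ** ?Y = - Z - mat \<i>"
    using matrix_mult_right_cancel[OF Y, of U "(- Z - mat \<i>) ** matrix_inv ?Y"]
    by (metis Y matrix_inv_left matrix_mul_assoc matrix_mul_rid)
  also have "\<dots> \<longleftrightarrow> (U - mat 1) ** Z = cscale \<i> (U + mat 1)"
    by (subst (1 2) mat_eq_cscale[of \<i>]) (auto simp: matrix_ring_simps algebra_simps)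
  finally show ?thesis .
qed

text \<open>With Y = i - Z the relation reads U Y = Y^*. Since Y commutes with its adjoint, U is
  unitary. The converse direction is needed to know what \<open>cayley_Z\<close> does off its
  domain.\<close>

lemma cayley_relation_imp_unitary:
  assumes Z: "self_adjoint_mat Z" and U: "(U - mat 1) ** Z = cscale \<i> (U + mat 1)"
  shows "unitary_mat U" "invertible (U - mat 1)"
proof -
  let ?Y = "- Z + mat \<i>"
  have Y: "invertible ?Y"
    by (rule invertible_self_adjoint_minus_i[OF Z])
  have Yadj: "cadj ?Y = - Z - mat \<i>"
    using Z by (simp add: cadj_simps cadj_mat self_adjoint_mat_def)
      (simp add: mat_eq_cscale[of "-\<i>"] mat_eq_cscale[of "\<i>"] cscale_neg)
  have UY: "U ** ?Y = cadj ?Y"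
    using U unfolding Yadj
    by (subst (1 2) mat_eq_cscale[of \<i>]) (auto simp: matrix_ring_simps algebra_simps)
  have normal: "?Y ** cadj ?Y = cadj ?Y ** ?Y"
    unfolding Yadj by (subst (1 2 3 4) mat_eq_cscale[of \<i>]) (simp add: matrix_ring_simps)
  have "cadj ?Y ** (cadj U ** U ** ?Y) = cadj (U ** ?Y) ** (U ** ?Y)"
    by (simp add: cadj_mult matrix_mul_assoc)
  also have "\<dots> = cadj ?Y ** ?Y"
    unfolding UY by (simp only: cadj_cadj normal)
  finally have "cadj U ** U ** ?Y = mat 1 ** ?Y"
    using matrix_mult_left_cancel[OF invertible_cadj[OF Y]] by simp
  then show "unitary_mat U"
    using matrix_mult_right_cancel[OF Y] by (intro unitary_matI) blast
  have "(U - mat 1) ** ?Y = - mat \<i> - mat \<i>"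
    using UY unfolding Yadj matrix_diff_rdistrib by simp
  \<comment> \<open>\<open>(U - mat 1) ** ?Y\<close> is -2i times the identity, and (-2i)(i/2) =
    1.\<close>
  then have "(U - mat 1) ** cscale (\<i> / 2) ?Y = mat 1"
    by (simp only: cscale_mult_right) (simp add: vec_eq_iff mat_def)
  then show "invertible (U - mat 1)"
    by (rule matrix_inv_unique)
qed

lemma cayley_Z_eq:
  assumes U: "unitary_mat U" and inv: "invertible (U - mat 1)"
  shows "self_adjoint_mat (cayley_Z U)" "(U - mat 1) ** cayley_Z U = cscale \<i> (U + mat 1)"
proof -
  define Z where "Z = matrix_inv (U - mat 1) ** cscale \<i> (U + mat 1)"
  have MZ: "(U - mat 1) ** Z = cscale \<i> (U + mat 1)"
    unfolding Z_def by (simp add: matrix_mul_assoc matrix_inv_right[OF inv])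
  \<comment> \<open>Sandwiching Z avoids the adjoint of an inverse: the right-hand side is visibly
    self-adjoint, and the two invertible outer factors cancel.\<close>
  have "(U - mat 1) ** Z ** cadj (U - mat 1) = cscale \<i> (cadj U - U)"
    unfolding MZ using U by (simp add: cadj_simps matrix_ring_simps unitary_matD)
  then have eq: "(U - mat 1) ** Z ** cadj (U - mat 1) = cadj ((U - mat 1) ** Z ** cadj (U - mat 1))"
    by (simp add: cadj_simps cscale_neg cscale_minus cscale_diff)
  then have "(U - mat 1) ** (Z ** cadj (U - mat 1)) = (U - mat 1) ** (cadj Z ** cadj (U - mat 1))"
    by (simp add: cadj_mult matrix_mul_assoc)
  then have sa: "self_adjoint_mat Z"
    unfolding self_adjoint_mat_def
    using matrix_mult_left_cancel[OF inv] matrix_mult_right_cancel[OF invertible_cadj[OF inv]]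
    by metis
  have "cayley_Z U = Z"
    unfolding cayley_Z_def
  proof (rule the_equality)
    show "self_adjoint_mat Z \<and> U = (- Z - mat \<i>) ** matrix_inv (- Z + mat \<i>)"
      using sa cayley_relation_iff[OF sa] MZ by simp
    fix Z' assume "self_adjoint_mat Z' \<and> U = (- Z' - mat \<i>) ** matrix_inv (- Z' + mat \<i>)"
    then have "(U - mat 1) ** Z' = cscale \<i> (U + mat 1)"
      using cayley_relation_iff by blast
    then show "Z' = Z"
      using MZ matrix_mult_left_cancel[OF inv] by metis
  qed
  then show "self_adjoint_mat (cayley_Z U)" "(U - mat 1) ** cayley_Z U = cscale \<i> (U + mat 1)"
    using sa MZ by simp_all
qed

text \<open>Outside the domain of the parametrization \<^term>\<open>cayley_Z\<close> is a description without witness,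
  hence one fixed junk matrix.\<close>

lemma cayley_Z_junk:
  assumes "\<not> (unitary_mat U \<and> invertible (U - mat 1))"
  shows "cayley_Z U = (THE Z. False)"
proof -
  have "\<not> (self_adjoint_mat Z \<and> U = (- Z - mat \<i>) ** matrix_inv (- Z + mat \<i>))" for Z
    using assms cayley_relation_iff cayley_relation_imp_unitary by blast
  then show ?thesis
    unfolding cayley_Z_def by (simp only:)
qed

section \<open>Existence and uniqueness of the Haar measure\<close>

lemma nn_integral_lborel_translate:
  fixes c :: "'a::euclidean_space"
  assumes [measurable]: "h \<in> borel_measurable borel"
  shows "(\<integral>\<^sup>+x. h (c + x) \<partial>lborel) = (\<integral>\<^sup>+x. h x \<partial>lborel)"
proof -
  have "(\<integral>\<^sup>+x. h x \<partial>lborel) = (\<integral>\<^sup>+x. h x \<partial>distr lborel borel ((+) c))"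
    by (simp add: lborel_distr_plus)
  also have "\<dots> = (\<integral>\<^sup>+x. h (c + x) \<partial>lborel)"
    by (subst nn_integral_distr) auto
  finally show ?thesis ..
qed

text \<open>The image of \<^term>\<open>lborel\<close> is again translation invariant, and two translation invariant
  measures are proportional by Fubini's theorem; the unit ball fixes the constant.\<close>

lemma lborel_distr_isometry:
  fixes f :: "'a::euclidean_space \<Rightarrow> 'a"
  assumes lin: "linear f" and isom: "\<And>x. norm (f x) = norm x"
  shows "distr lborel borel f = lborel"
proof (rule measure_eqI)
  fix A assume "A \<in> sets (distr lborel borel f)"
  then have A [measurable]: "A \<in> sets borel" by simp
  have f [measurable]: "f \<in> borel_measurable borel"
    using lin by (intro borel_measurable_continuous_onI linear_continuous_on)
      (simp add: linear_conv_bounded_linear)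
  have "inj f"
    using lin isom by (simp add: linear_injective_0) (metis norm_eq_zero)
  then have "surj f"
    using lin linear_injective_imp_surjective by blast
  then obtain g where g: "\<And>y. f (g y) = y"
    by (metis surj_def)
  define B :: "'a set" where "B = ball 0 1"
  have B [measurable]: "B \<in> sets borel"
    by (simp add: B_def)
  let ?ind = "\<lambda>S x. indicator S x :: ennreal"
  have "emeasure (distr lborel borel f) A = (\<integral>\<^sup>+x. ?ind A x \<partial>distr lborel borel f)"
    by simp
  also have "\<dots> = (\<integral>\<^sup>+x. ?ind A (f x) \<partial>lborel)"
    by (subst nn_integral_distr) auto
  finally have "emeasure (distr lborel borel f) A * emeasure lborel B
      = (\<integral>\<^sup>+x. ?ind A (f x) * emeasure lborel B \<partial>lborel)"
    by (simp add: nn_integral_multc)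
  also have "\<dots> = (\<integral>\<^sup>+x. (\<integral>\<^sup>+y. ?ind A (f x) * ?ind B (y - f x) \<partial>lborel) \<partial>lborel)"
  proof (rule nn_integral_cong)
    fix x
    have "(\<integral>\<^sup>+y. ?ind B (- f x + y) \<partial>lborel) = emeasure lborel B"
      by (subst nn_integral_lborel_translate) auto
    then show "?ind A (f x) * emeasure lborel B = (\<integral>\<^sup>+y. ?ind A (f x) * ?ind B (y - f x) \<partial>lborel)"
      by (simp add: nn_integral_cmult)
  qed
  also have "\<dots> = (\<integral>\<^sup>+y. (\<integral>\<^sup>+x. ?ind A (f x) * ?ind B (y - f x) \<partial>lborel) \<partial>lborel)"
    by (rule lborel_pair.Fubini') measurable
  also have "\<dots> = (\<integral>\<^sup>+y. (\<integral>\<^sup>+x. ?ind A (y + f x) * ?ind B x \<partial>lborel) \<partial>lborel)"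
  proof (rule nn_integral_cong)
    fix y
    \<comment> \<open>Shifting x by a preimage of y turns y - f x into - f x, which lies in the ball
      exactly when x does, because f preserves norms.\<close>
    have "(\<integral>\<^sup>+x. ?ind A (f x) * ?ind B (y - f x) \<partial>lborel)
        = (\<integral>\<^sup>+x. ?ind A (f (g y + x)) * ?ind B (y - f (g y + x)) \<partial>lborel)"
      by (subst nn_integral_lborel_translate[where h = "\<lambda>x. ?ind A (f x) * ?ind B (y - f x)"]) auto
    also have "\<dots> = (\<integral>\<^sup>+x. ?ind A (y + f x) * ?ind B x \<partial>lborel)"
      by (intro nn_integral_cong) (simp add: linear_add[OF lin] g B_def indicator_def isom)
    finally show "(\<integral>\<^sup>+x. ?ind A (f x) * ?ind B (y - f x) \<partial>lborel)
        = (\<integral>\<^sup>+x. ?ind A (y + f x) * ?ind B x \<partial>lborel)" .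
  qed
  also have "\<dots> = (\<integral>\<^sup>+x. (\<integral>\<^sup>+y. ?ind A (y + f x) * ?ind B x \<partial>lborel) \<partial>lborel)"
    by (rule lborel_pair.Fubini') measurable
  also have "\<dots> = (\<integral>\<^sup>+x. emeasure lborel A * ?ind B x \<partial>lborel)"
  proof (rule nn_integral_cong)
    fix x
    have "(\<integral>\<^sup>+y. ?ind A (f x + y) \<partial>lborel) = emeasure lborel A"
      by (subst nn_integral_lborel_translate) auto
    then show "(\<integral>\<^sup>+y. ?ind A (y + f x) * ?ind B x \<partial>lborel) = emeasure lborel A * ?ind B x"
      by (simp add: nn_integral_multc add.commute)
  qed
  also have "\<dots> = emeasure lborel A * emeasure lborel B"
    by (simp add: nn_integral_cmult)
  finally have "emeasure (distr lborel borel f) A * emeasure lborel B = emeasure lborel A * emeasure lborel B" .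
  moreover have "emeasure lborel B \<noteq> 0" "emeasure lborel B \<noteq> \<infinity>"
    using open_not_negligible[of B] emeasure_lborel_ball_finite[of "0::'a" 1]
    by (auto simp: B_def negligible_iff_emeasure0 emeasure_lborel_ball_finite)
  ultimately show "emeasure (distr lborel borel f) A = emeasure lborel A"
    by (metis mult_divide_eq_ennreal infinity_ennreal_def)
qed simp

text \<open>The predicate under the description in \<open>haar_unitary\<close>, named so that its
  existence and uniqueness can be stated. The invariance is one-sided, which is why uniqueness
  passes through the adjoint.\<close>

definition haar_like :: "(complex^'l^'l) measure \<Rightarrow> bool" where
  "haar_like \<mu> \<longleftrightarrow> prob_space \<mu> \<and> sets \<mu> = sets borel \<and> emeasure \<mu> {U. \<not> unitary_mat U} = 0 \<and>
      (\<forall>W. unitary_mat W \<longrightarrow> distr \<mu> borel (\<lambda>U. W ** U) = \<mu>)"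

lemma matrix_mult_measurable [measurable (raw)]:
  fixes f g :: "'a \<Rightarrow> complex^'l^'l"
  assumes "f \<in> borel_measurable M" "g \<in> borel_measurable M"
  shows "(\<lambda>x. f x ** g x) \<in> borel_measurable M"
  by (rule borel_measurable_continuous_Pair[OF assms]) (auto intro!: continuous_intros)

lemma cadj_measurable [measurable]: "cadj \<in> borel_measurable (borel :: (complex^'l^'l) measure)"
  by (intro borel_measurable_continuous_onI continuous_on_cadj continuous_on_id)

lemma cscale_measurable [measurable]: "cscale c \<in> borel_measurable (borel :: (complex^'l^'l) measure)"
  by (intro borel_measurable_continuous_onI continuous_on_cscale continuous_on_id)

lemma haar_like_AE:
  assumes "haar_like \<mu>"
  shows "AE U in \<mu>. unitary_mat U"
proof -
  have "sets \<mu> = sets borel" "emeasure \<mu> {U. \<not> unitary_mat U} = 0"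
    using assms by (auto simp: haar_like_def)
  moreover have "{U. \<not> unitary_mat U} \<in> sets borel"
    using sets.compl_sets[OF borel_unitary] by (simp add: Collect_neg_eq Compl_eq_Diff_UNIV)
  ultimately show ?thesis
    by (intro AE_I[of _ _ "{U. \<not> unitary_mat U}"]) auto
qed

lemma haar_like_nn_integral:
  assumes "haar_like \<mu>" "unitary_mat W" "h \<in> borel_measurable borel"
  shows "(\<integral>\<^sup>+U. h (W ** U) \<partial>\<mu>) = (\<integral>\<^sup>+U. h U \<partial>\<mu>)"
proof -
  have \<mu>: "sets \<mu> = sets borel" "distr \<mu> borel (\<lambda>U. W ** U) = \<mu>"
    using assms by (auto simp: haar_like_def)
  have "(\<integral>\<^sup>+U. h U \<partial>\<mu>) = (\<integral>\<^sup>+U. h U \<partial>distr \<mu> borel (\<lambda>U. W ** U))"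
    by (simp add: \<mu>)
  also have "\<dots> = (\<integral>\<^sup>+U. h (W ** U) \<partial>\<mu>)"
    using assms(3) by (intro nn_integral_distr) (auto simp: measurable_cong_sets[OF \<mu>(1) refl])
  finally show ?thesis ..
qed

text \<open>Integrating \<open>h (U\<^sup>* W)\<close> in both orders: left invariance in \<open>W\<close> removes \<open>U\<^sup>*\<close>, while the
  substitution of \<open>W U\<close> for \<open>U\<close> removes \<open>W\<close>.\<close>

lemma haar_like_cadj:
  assumes \<mu>: "haar_like \<mu>" and \<nu>: "haar_like \<nu>" and h [measurable]: "h \<in> borel_measurable borel"
  shows "(\<integral>\<^sup>+W. h W \<partial>\<nu>) = (\<integral>\<^sup>+U. h (cadj U) \<partial>\<mu>)"
proof -
  have s [measurable_cong]: "sets \<mu> = sets borel" "sets \<nu> = sets borel"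
    and p: "prob_space \<mu>" "prob_space \<nu>"
    using \<mu> \<nu> by (auto simp: haar_like_def)
  interpret \<mu>: prob_space \<mu> by fact
  interpret \<nu>: prob_space \<nu> by fact
  interpret pair_sigma_finite \<mu> \<nu> ..
  have "(\<integral>\<^sup>+W. h W \<partial>\<nu>) = (\<integral>\<^sup>+U. (\<integral>\<^sup>+W. h W \<partial>\<nu>) \<partial>\<mu>)"
    by (simp add: \<mu>.emeasure_space_1)
  also have "\<dots> = (\<integral>\<^sup>+U. (\<integral>\<^sup>+W. h (cadj U ** W) \<partial>\<nu>) \<partial>\<mu>)"
    using haar_like_AE[OF \<mu>]
    by (intro nn_integral_cong_AE) (auto elim!: eventually_mono simp: haar_like_nn_integral[OF \<nu> unitary_cadj h])
  also have "\<dots> = (\<integral>\<^sup>+W. (\<integral>\<^sup>+U. h (cadj U ** W) \<partial>\<mu>) \<partial>\<nu>)"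
    by (rule Fubini'[symmetric]) measurable
  also have "\<dots> = (\<integral>\<^sup>+W. (\<integral>\<^sup>+U. h (cadj U) \<partial>\<mu>) \<partial>\<nu>)"
  proof (rule nn_integral_cong_AE, use haar_like_AE[OF \<nu>] in eventually_elim)
    fix W :: "complex^'a^'a" assume W: "unitary_mat W"
    have "(\<integral>\<^sup>+U. h (cadj U ** W) \<partial>\<mu>) = (\<integral>\<^sup>+U. h (cadj (W ** U) ** W) \<partial>\<mu>)"
      by (rule haar_like_nn_integral[OF \<mu> W, symmetric]) measurable
    also have "\<dots> = (\<integral>\<^sup>+U. h (cadj U) \<partial>\<mu>)"
      using W by (simp add: cadj_mult matrix_mul_assoc[symmetric] unitary_matD)
    finally show "(\<integral>\<^sup>+U. h (cadj U ** W) \<partial>\<mu>) = (\<integral>\<^sup>+U. h (cadj U) \<partial>\<mu>)" .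
  qed
  also have "\<dots> = (\<integral>\<^sup>+U. h (cadj U) \<partial>\<mu>)"
    by (simp add: \<nu>.emeasure_space_1)
  finally show ?thesis .
qed

text \<open>\<open>haar_like_cadj\<close> for the pair \<open>\<mu>\<close>, \<open>\<nu>\<close>
  and for the pair \<open>\<mu>\<close>, \<open>\<mu>\<close> has the same right-hand side.\<close>

lemma haar_like_unique:
  assumes "haar_like \<mu>" "haar_like \<nu>"
  shows "\<mu> = \<nu>"
proof (rule measure_eqI)
  show "sets \<mu> = sets \<nu>"
    using assms by (simp add: haar_like_def)
  fix A assume "A \<in> sets \<mu>"
  then have A: "A \<in> sets borel" "A \<in> sets \<mu>" "A \<in> sets \<nu>"
    using assms by (auto simp: haar_like_def)
  then have "(indicator A :: _ \<Rightarrow> ennreal) \<in> borel_measurable borel"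
    by measurable
  then have "(\<integral>\<^sup>+W. indicator A W \<partial>\<mu>) = (\<integral>\<^sup>+W. indicator A W \<partial>\<nu>)"
    using haar_like_cadj assms by metis
  then show "emeasure \<mu> A = emeasure \<nu> A"
    using A by simp
qed

text \<open>The Newton--Schulz iteration: the defect \<open>X\<^sup>* X - 1\<close> decays quadratically once it is small, and
  every step commutes with left multiplication by unitaries.\<close>

fun polar_iter :: "nat \<Rightarrow> complex^'l^'l \<Rightarrow> complex^'l^'l" where
  "polar_iter 0 X = X"
| "polar_iter (Suc n) X =
     polar_iter n X - (1/2) *\<^sub>R (polar_iter n X ** (cadj (polar_iter n X) ** polar_iter n X - mat 1))"

text \<open>A bounded open set around the identity, hence of finite positive Lebesgue measure, and
  stable under unitaries. Below 1/2, squaring the defect at least halves it.\<close>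

definition polar_domain :: "(complex^'l^'l) set" where
  "polar_domain = {X. norm (cadj X ** X - mat 1) < 1/2}"

definition polar_factor :: "complex^'l^'l \<Rightarrow> complex^'l^'l" where
  "polar_factor X = lim (\<lambda>n. polar_iter n X)"

lemma polar_iter_unitary:
  assumes "unitary_mat W"
  shows "polar_iter n (W ** X) = W ** polar_iter n X"
  by (induction n)
    (simp_all add: cadj_mult matrix_ring_simps unitary_cancel[OF assms])

lemma continuous_on_polar_iter: "continuous_on UNIV (polar_iter n :: complex^'l^'l \<Rightarrow> _)"
  by (induction n) (auto intro!: continuous_intros)

lemma polar_factor_measurable [measurable]:
  "polar_factor \<in> borel_measurable (borel :: (complex^'l^'l) measure)"
  unfolding polar_factor_def[abs_def]
  by (intro borel_measurable_lim_metric borel_measurable_continuous_onI continuous_on_polar_iter)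

text \<open>Put F = Y^* Y = 1 + E. The step multiplies Y by (3 - F)/2, so F becomes F (3 - F)^2 / 4.
  Expanding in E, the linear terms cancel.\<close>

lemma polar_iter_defect:
  fixes X :: "complex^'l^'l"
  defines "E \<equiv> \<lambda>n. cadj (polar_iter n X) ** polar_iter n X - mat 1"
  shows "E (Suc n) = (1/4) *\<^sub>R (E n ** E n ** E n) - (3/4) *\<^sub>R (E n ** E n)"
proof -
  let ?Y = "polar_iter n X"
  define F where "F = cadj ?Y ** ?Y"
  have F: "cadj F = F"
    by (simp add: F_def cadj_mult)
  have Y: "polar_iter (Suc n) X = ?Y ** ((3/2) *\<^sub>R mat 1 - (1/2) *\<^sub>R F)"
    by (simp add: F_def matrix_ring_simps algebra_simps vec_eq_iff) (simp add: scaleR_conv_of_real)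
  have key: "cadj (polar_iter (Suc n) X) ** polar_iter (Suc n) X
      = ((3/2) *\<^sub>R mat 1 - (1/2) *\<^sub>R F) ** F ** ((3/2) *\<^sub>R mat 1 - (1/2) *\<^sub>R F)"
    unfolding Y cadj_mult by (simp add: cadj_simps F matrix_mul_assoc) (simp add: F_def matrix_mul_assoc)
  show ?thesis
    unfolding E_def key F_def[symmetric]
    by (simp only: matrix_ring_simps matrix_mul_lid matrix_mul_rid vec_eq_iff
        vector_add_component vector_minus_component vector_scaleR_component)
      (simp add: scaleR_conv_of_real field_simps)
qed

lemma polar_factor:
  fixes X :: "complex^'l^'l"
  assumes "X \<in> polar_domain"
  shows "(\<lambda>n. polar_iter n X) \<longlonglongrightarrow> polar_factor X" "unitary_mat (polar_factor X)"
proof -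
  define Y where "Y = (\<lambda>n. polar_iter n X)"
  define E where "E = (\<lambda>n. cadj (Y n) ** Y n - mat 1)"
  have E_Suc: "norm (E (Suc n)) \<le> (norm (E n))\<^sup>2" if "norm (E n) \<le> 1" for n
  proof -
    let ?e = "norm (E n)"
    have E2: "norm (E n ** E n) \<le> ?e\<^sup>2"
      using norm_matrix_mult_le[of "E n" "E n"] by (simp add: power2_eq_square)
    have "norm (E n ** E n ** E n) \<le> norm (E n ** E n) * ?e"
      by (rule norm_matrix_mult_le)
    also have "\<dots> \<le> ?e\<^sup>2 * 1"
      using E2 that by (intro mult_mono) auto
    finally have E3: "norm (E n ** E n ** E n) \<le> ?e\<^sup>2"
      by simp
    \<comment> \<open>The coefficients 1/4 and 3/4 add up to 1, so the quadratic bound carries no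
      constant.\<close>
    have "norm (E (Suc n)) \<le> norm ((1/4) *\<^sub>R (E n ** E n ** E n)) + norm ((3/4) *\<^sub>R (E n ** E n))"
      unfolding E_def Y_def polar_iter_defect by (rule norm_triangle_ineq4)
    then show ?thesis
      using E2 E3 by simp
  qed
  have E_le: "norm (E n) \<le> (1/2) ^ Suc n" for n
  proof (induction n)
    case 0
    then show ?case
      using assms by (simp add: E_def Y_def polar_domain_def)
  next
    case (Suc n)
    have "(1/2 :: real) ^ Suc n \<le> 1/2"
      by (simp add: power_le_one)
    then have half: "norm (E n) \<le> 1/2"
      using Suc by linarith
    then have "norm (E (Suc n)) \<le> norm (E n) * norm (E n)"
      using E_Suc[of n] by (simp add: power2_eq_square)
    also have "\<dots> \<le> (1/2) ^ Suc n * (1/2)"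
      using Suc half by (intro mult_mono) auto
    finally show ?case
      by simp
  qed
  \<comment> \<open>The squared norm of an iterate is the inner product of the identity with 1 + E
    n, and E n has norm at most 1. In this norm the identity has length the square root of
    L.\<close>
  define B where "B = sqrt (norm (mat 1 :: complex^'l^'l) * (norm (mat 1 :: complex^'l^'l) + 1))"
  have Y_le: "norm (Y n) \<le> B" for n
  proof -
    have "(norm (Y n))\<^sup>2 \<le> norm (mat 1 :: complex^'l^'l) * norm (mat 1 + E n)"
      unfolding norm_matrix_sq[of "Y n"] E_def
      using norm_cauchy_schwarz[of "mat 1 :: complex^'l^'l" "cadj (Y n) ** Y n"] by simp
    also have "norm (mat 1 + E n) \<le> norm (mat 1 :: complex^'l^'l) + 1"
      using norm_triangle_ineq[of "mat 1" "E n"] E_le[of n] power_le_one[of "1/2::real" "Suc n"] by simp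
    finally show ?thesis
      unfolding B_def by (intro real_le_rsqrt) (simp add: mult_left_mono)
  qed
  \<comment> \<open>Successive iterates differ by half of Y n times E n, a bounded factor times a
    geometrically small one.\<close>
  have "summable (\<lambda>n. Y (Suc n) - Y n)"
  proof (rule summable_comparison_test')
    show "summable (\<lambda>n. (1/2 * B) * (1/2 :: real) ^ Suc n)"
      by (intro summable_mult) (simp add: summable_geometric)
    fix n
    have "norm (Y (Suc n) - Y n) = 1/2 * norm (Y n ** E n)"
      by (simp add: Y_def E_def)
    also have "norm (Y n ** E n) \<le> B * (1/2) ^ Suc n"
      using norm_matrix_mult_le[of "Y n" "E n"] mult_mono[OF Y_le[of n] E_le[of n]] by (auto simp: B_def)
    finally show "norm (Y (Suc n) - Y n) \<le> (1/2 * B) * (1/2) ^ Suc n"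
      by simp
  qed
  then have "(\<lambda>n. \<Sum>k<n. Y (Suc k) - Y k) \<longlonglongrightarrow> (\<Sum>k. Y (Suc k) - Y k)"
    by (rule summable_LIMSEQ)
  then have "(\<lambda>n. (Y n - Y 0) + Y 0) \<longlonglongrightarrow> (\<Sum>k. Y (Suc k) - Y k) + Y 0"
    unfolding sum_lessThan_telescope by (intro tendsto_intros)
  then have "convergent Y"
    by (auto simp: convergent_def)
  then show lim: "(\<lambda>n. polar_iter n X) \<longlonglongrightarrow> polar_factor X"
    unfolding polar_factor_def Y_def by (rule convergent_LIMSEQ_iff[THEN iffD1])
  then have "E \<longlonglongrightarrow> cadj (polar_factor X) ** polar_factor X - mat 1"
    unfolding E_def Y_def by (intro tendsto_intros)
  moreover have "E \<longlonglongrightarrow> 0"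
  proof (rule Lim_null_comparison)
    show "\<forall>\<^sub>F n in sequentially. norm (E n) \<le> (1/2) ^ Suc n"
      using E_le by simp
    show "(\<lambda>n. (1/2 :: real) ^ Suc n) \<longlonglongrightarrow> 0"
      by (intro LIMSEQ_Suc LIMSEQ_realpow_zero) auto
  qed
  ultimately have "cadj (polar_factor X) ** polar_factor X - mat 1 = 0"
    by (rule LIMSEQ_unique)
  then show "unitary_mat (polar_factor X)"
    by (intro unitary_matI) simp
qed

lemma polar_domain_unitary:
  assumes "unitary_mat W"
  shows "W ** X \<in> polar_domain \<longleftrightarrow> X \<in> polar_domain"
  by (simp add: polar_domain_def cadj_mult matrix_mul_assoc[symmetric] unitary_cancel[OF assms])

lemma polar_factor_unitary:
  assumes "unitary_mat W" "X \<in> polar_domain"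
  shows "polar_factor (W ** X) = W ** polar_factor X"
proof -
  have "(\<lambda>n. W ** polar_iter n X) \<longlonglongrightarrow> W ** polar_factor X"
    by (intro tendsto_intros polar_factor assms)
  moreover have "(\<lambda>n. W ** polar_iter n X) \<longlonglongrightarrow> polar_factor (W ** X)"
    using polar_factor(1)[of "W ** X"] assms
    by (simp add: polar_domain_unitary polar_iter_unitary)
  ultimately show ?thesis
    using LIMSEQ_unique by blast
qed

lemma open_polar_domain: "open (polar_domain :: (complex^'l^'l) set)"
  unfolding polar_domain_def by (intro open_Collect_less continuous_intros)

lemma bounded_polar_domain: "bounded (polar_domain :: (complex^'l^'l) set)"
proof (rule boundedI)
  fix X :: "complex^'l^'l" assume X: "X \<in> polar_domain"
  let ?n = "norm (mat 1 :: complex^'l^'l)"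
  have "(norm X)\<^sup>2 \<le> ?n * norm (cadj X ** X)"
    unfolding norm_matrix_sq[of X] by (rule norm_cauchy_schwarz)
  also have "\<dots> \<le> ?n * (?n + 1/2)"
    using X norm_triangle_ineq2[of "cadj X ** X" "mat 1"]
    by (intro mult_left_mono) (auto simp: polar_domain_def)
  finally show "norm X \<le> sqrt (?n * (?n + 1/2))"
    by (rule real_le_rsqrt)
qed

lemma haar_like_exists: "\<exists>\<mu> :: (complex^'l^'l) measure. haar_like \<mu>"
proof -
  let ?D = "polar_domain :: (complex^'l^'l) set"
  define P where "P = uniform_measure lborel ?D"
  define \<mu> where "\<mu> = distr P borel polar_factor"
  have D [measurable]: "?D \<in> sets borel"
    by (intro borel_open open_polar_domain)
  have nz: "emeasure lborel ?D \<noteq> 0"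
  proof -
    have "mat 1 \<in> ?D"
      by (simp add: polar_domain_def)
    then have "\<not> negligible ?D"
      using open_not_negligible[OF open_polar_domain] by blast
    then show ?thesis
      by (simp add: negligible_iff_emeasure0)
  qed
  have fin: "emeasure lborel ?D < \<infinity>"
    by (rule emeasure_bounded_finite[OF bounded_polar_domain])
  have s [measurable_cong]: "sets P = sets borel"
    by (simp add: P_def)
  have PD: "AE X in P. X \<in> ?D"
    unfolding P_def by (intro AE_uniform_measureI) auto
  have "prob_space P"
    unfolding P_def using nz fin by (intro prob_space_uniform_measure) auto
  then have "prob_space \<mu>"
    unfolding \<mu>_def by (intro prob_space.prob_space_distr) measurable
  moreover have "sets \<mu> = sets borel"
    by (simp add: \<mu>_def)
  moreover have "emeasure \<mu> {U. \<not> unitary_mat U} = 0"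
  proof -
    have m: "{U :: complex^'l^'l. \<not> unitary_mat U} \<in> sets borel"
      using sets.compl_sets[OF borel_unitary] by (simp add: Collect_neg_eq Compl_eq_Diff_UNIV)
    have "AE X in P. unitary_mat (polar_factor X)"
      using PD by eventually_elim (rule polar_factor)
    then have "emeasure P {X \<in> space P. \<not> unitary_mat (polar_factor X)} = 0"
      by (intro emeasure_eq_0_AE) simp
    moreover have "polar_factor -` {U. \<not> unitary_mat U} \<inter> space P = {X \<in> space P. \<not> unitary_mat (polar_factor X)}"
      by auto
    moreover have "polar_factor \<in> borel_measurable P"
      by measurable
    ultimately show ?thesis
      unfolding \<mu>_def by (simp only: emeasure_distr[OF _ m])
  qed
  moreover have "distr \<mu> borel (\<lambda>U. W ** U) = \<mu>" if W: "unitary_mat W" for W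
  proof -
    \<comment> \<open>Left multiplication by W is a linear isometry that preserves
      \<open>polar_domain\<close>, so it preserves normalized Lebesgue measure there.\<close>
    have inv: "distr P borel (\<lambda>X. W ** X) = P"
    proof (rule measure_eqI)
      fix A assume "A \<in> sets (distr P borel (\<lambda>X. W ** X))"
      then have A [measurable]: "A \<in> sets borel" by simp
      have W_lborel: "distr lborel borel (\<lambda>X :: complex^'l^'l. W ** X) = lborel"
        by (intro lborel_distr_isometry linearI)
          (simp_all add: matrix_ring_simps norm_unitary_mult[OF W])
      have "emeasure (distr P borel (\<lambda>X. W ** X)) A = emeasure P ((\<lambda>X. W ** X) -` A)"
        by (subst emeasure_distr) (auto simp: P_def)
      also have "\<dots> = emeasure lborel (?D \<inter> (\<lambda>X. W ** X) -` A) / emeasure lborel ?D"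
        unfolding P_def
        by (subst emeasure_uniform_measure) (auto intro!: measurable_sets_borel[OF _ A])
      also have "?D \<inter> (\<lambda>X. W ** X) -` A = (\<lambda>X. W ** X) -` (?D \<inter> A)"
        by (auto simp: polar_domain_unitary[OF W])
      also have "emeasure lborel ((\<lambda>X. W ** X) -` (?D \<inter> A)) = emeasure (distr lborel borel (\<lambda>X. W ** X)) (?D \<inter> A)"
        by (subst emeasure_distr) auto
      also have "\<dots> / emeasure lborel ?D = emeasure P A"
        unfolding W_lborel P_def by simp
      finally show "emeasure (distr P borel (\<lambda>X. W ** X)) A = emeasure P A" .
    qed (simp add: s)
    have "distr \<mu> borel (\<lambda>U. W ** U) = distr P borel (\<lambda>X. W ** polar_factor X)"
      unfolding \<mu>_def by (subst distr_distr) (auto simp: comp_def)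
    \<comment> \<open>The equivariance of \<open>polar_factor\<close> is known on
      \<open>polar_domain\<close> only, which carries all the mass of \<open>P\<close>.\<close>
    also have "\<dots> = distr P borel (\<lambda>X. polar_factor (W ** X))"
    proof (rule distr_cong_AE)
      show "AE X in P. W ** polar_factor X = polar_factor (W ** X)"
        using PD by eventually_elim (simp add: polar_factor_unitary[OF W])
    qed (auto, measurable)
    also have "\<dots> = distr (distr P borel (\<lambda>X. W ** X)) borel polar_factor"
      by (subst distr_distr) (auto simp: comp_def)
    also have "\<dots> = \<mu>"
      unfolding inv \<mu>_def ..
    finally show ?thesis .
  qed
  ultimately have "haar_like \<mu>"
    by (auto simp: haar_like_def)
  then show ?thesis ..
qed

lemma haar_like_haar_unitary: "haar_like (haar_unitary :: (complex^'l^'l) measure)"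
proof -
  have "\<exists>!\<mu> :: (complex^'l^'l) measure. haar_like \<mu>"
    using haar_like_exists haar_like_unique by blast
  then show ?thesis
    unfolding haar_unitary_def haar_like_def[symmetric] by (rule theI')
qed

section \<open>Integrals against the Haar measure\<close>

lemma prob_space_haar: "prob_space (haar_unitary :: (complex^'l^'l) measure)"
  and sets_haar [measurable_cong, simp]: "sets (haar_unitary :: (complex^'l^'l) measure) = sets borel"
  using haar_like_haar_unitary by (auto simp: haar_like_def)

lemma space_haar [simp]: "space (haar_unitary :: (complex^'l^'l) measure) = UNIV"
  using sets_eq_imp_space_eq[OF sets_haar] by simp

lemma AE_haar_unitary: "AE U in (haar_unitary :: (complex^'l^'l) measure). unitary_mat U"
  by (rule haar_like_AE[OF haar_like_haar_unitary])

lemma distr_haar_cscale: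
  assumes "cmod \<omega> = 1"
  shows "distr haar_unitary borel (cscale \<omega>) = (haar_unitary :: (complex^'l^'l) measure)"
proof -
  have "unitary_mat (cscale \<omega> (mat 1) :: complex^'l^'l)"
    using assms by (intro unitary_cscale unitary_matI) simp_all
  moreover have "cscale \<omega> = (\<lambda>U :: complex^'l^'l. cscale \<omega> (mat 1) ** U)"
    by (simp add: fun_eq_iff cscale_mult_left)
  ultimately show ?thesis
    using haar_like_haar_unitary by (auto simp: haar_like_def)
qed

text \<open>For a monomial of positive degree some phase produces the factor -1. Restricting to this
  sign lets the values lie in any real Banach space.\<close>

lemma haar_integral_odd:
  fixes h :: "complex^'l^'l \<Rightarrow> 'b::{banach, second_countable_topology}"
  assumes [measurable]: "h \<in> borel_measurable borel"
    and "cmod \<omega> = 1" and "\<And>U. h (cscale \<omega> U) = - h U"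
  shows "(LINT U|haar_unitary. h U) = 0"
proof -
  have "(LINT U|haar_unitary. h U) = (LINT U|distr haar_unitary borel (cscale \<omega>). h U)"
    by (simp add: distr_haar_cscale assms)
  also have "\<dots> = (LINT U|haar_unitary. h (cscale \<omega> U))"
    by (subst integral_distr) auto
  also have "\<dots> = - (LINT U|haar_unitary. h U)"
    by (simp add: assms)
  finally have "2 *\<^sub>R (LINT U|haar_unitary. h U) = 0"
    by (simp add: scaleR_2 eq_neg_iff_add_eq_0)
  then show ?thesis
    by simp
qed

text \<open>The determinant of t U - 1 is a polynomial in t of degree at most L. It is not zero,
  since at t = 0 it is the determinant of -1.\<close>

lemma card_singular_scalars:
  fixes U :: "complex^'l^'l"
  shows "finite {t. \<not> invertible (cscale t U - mat 1)}"
    and "card {t. \<not> invertible (cscale t U - mat 1)} \<le> CARD('l)"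
proof -
  define q where "q = (\<Sum>p | p permutes (UNIV :: 'l set).
    smult (of_int (sign p)) (\<Prod>i\<in>UNIV. [: - (mat 1 $ i $ p i), U $ i $ p i :]))"
  have q: "poly q t = det (cscale t U - mat 1)" for t
    by (simp add: q_def poly_sum poly_prod det_def mult.commute)
  have "degree q \<le> CARD('l)"
    unfolding q_def
  proof (rule degree_sum_le)
    fix p
    have "degree (\<Prod>i\<in>UNIV. [: - (mat 1 $ i $ p i), U $ i $ p i :])
        \<le> (\<Sum>i\<in>UNIV. degree [: - (mat 1 $ i $ p i), U $ i $ p i :])"
      using degree_prod_sum_le[of UNIV "\<lambda>i. [: - (mat 1 $ i $ p i), U $ i $ p i :]"] by (simp add: comp_def)
    also have "\<dots> \<le> (\<Sum>i\<in>(UNIV :: 'l set). 1)"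
      by (intro sum_mono) simp
    finally show "degree (smult (of_int (sign p)) (\<Prod>i\<in>UNIV. [: - (mat 1 $ i $ p i), U $ i $ p i :])) \<le> CARD('l)"
      by simp
  qed (simp add: finite_permutations)
  moreover have "q \<noteq> 0"
  proof
    assume "q = 0"
    then have "det (- mat 1 :: complex^'l^'l) = 0"
      using q[of 0] by (simp add: cscale_def zero_vec_def[symmetric] vec_lambda_eta)
    moreover have "invertible (- mat 1 :: complex^'l^'l)"
      by (rule matrix_inv_unique[of _ "- mat 1"]) (simp add: matrix_ring_simps)
    ultimately show False
      by (simp add: invertible_det_nz)
  qed
  moreover have "{t. \<not> invertible (cscale t U - mat 1)} = {t. poly q t = 0}"
    by (simp add: q invertible_det_nz)
  ultimately show "finite {t. \<not> invertible (cscale t U - mat 1)}"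
    "card {t. \<not> invertible (cscale t U - mat 1)} \<le> CARD('l)"
    using poly_roots_finite[of q] card_poly_roots_bound[of q] by auto
qed

text \<open>The sets of \<open>U\<close> with eigenvalue \<open>1/\<omega>\<close>, for \<open>\<omega>\<close> on the unit circle, all have the same
  measure, and each \<open>U\<close> lies in at most \<open>L\<close> of them.\<close>

lemma AE_haar_no_eigenvalue_1:
  "AE U in (haar_unitary :: (complex^'l^'l) measure). invertible (U - mat 1)"
proof -
  interpret prob_space "haar_unitary :: (complex^'l^'l) measure"
    by (rule prob_space_haar)
  define B where "B = (\<lambda>t. {U :: complex^'l^'l. \<not> invertible (cscale t U - mat 1)})"
  have B [measurable]: "B t \<in> sets borel" for t
  proof -
    have "B t = (\<lambda>U. cscale t U - mat 1) -` (- {A. invertible A})"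
      by (auto simp: B_def)
    moreover have "closed ((\<lambda>U :: complex^'l^'l. cscale t U - mat 1) -` (- {A. invertible A}))"
      by (intro closed_vimage closed_Compl open_invertible continuous_intros)
    ultimately show ?thesis
      by simp
  qed
  have inv: "prob (B t) = prob (B 1)" if "cmod t = 1" for t
  proof -
    have "prob (B 1) = measure (distr haar_unitary borel (cscale t)) (B 1)"
      using that by (simp add: distr_haar_cscale)
    also have "\<dots> = prob (cscale t -` B 1)"
      by (subst measure_distr) auto
    also have "cscale t -` B 1 = B t"
      by (auto simp: B_def cscale_one)
    finally show ?thesis ..
  qed
  have bound: "real n * prob (B 1) \<le> CARD('l)" if "n > 0" for n
  proof -
    \<comment> \<open>The n-th roots of unity are n points of the circle. Integrating the number of
      sets \<open>B t\<close> that contain U, which is at most L, bounds n times their common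
      measure uniformly in n.\<close>
    define F where "F = {z :: complex. z ^ n = 1}"
    have F: "finite F" "card F = n"
      using that card_roots_unity_eq[of n] by (auto simp: F_def intro: finite_roots_unity)
    have "cmod z = 1" if "z \<in> F" for z
    proof -
      have "cmod z ^ n = 1 ^ n"
        using that by (simp add: F_def norm_power[symmetric])
      then show ?thesis
        using \<open>n > 0\<close> power_eq_imp_eq_base[of "cmod z" n 1] by simp
    qed
    then have "(\<Sum>t\<in>F. prob (B t)) = (\<Sum>t\<in>F. prob (B 1))"
      by (intro sum.cong refl inv)
    then have "real n * prob (B 1) = (\<Sum>t\<in>F. prob (B t))"
      using F by simp
    also have "\<dots> = (\<Sum>t\<in>F. expectation (indicator (B t)))"
      by simp
    also have "\<dots> = expectation (\<lambda>U. \<Sum>t\<in>F. indicator (B t) U)"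
      by (rule Bochner_Integration.integral_sum[symmetric]) (simp add: emeasure_eq_measure)
    also have "\<dots> \<le> expectation (\<lambda>U. real CARD('l))"
    proof (rule integral_mono)
      fix U :: "complex^'l^'l"
      have "(\<Sum>t\<in>F. indicator (B t) U :: real) = real (card {t \<in> F. U \<in> B t})"
        using F by (simp add: indicator_def sum.If_cases Int_def)
      also have "card {t \<in> F. U \<in> B t} \<le> card {t. \<not> invertible (cscale t U - mat 1)}"
        by (intro card_mono card_singular_scalars) (auto simp: B_def)
      also have "\<dots> \<le> CARD('l)"
        by (rule card_singular_scalars)
      finally show "(\<Sum>t\<in>F. indicator (B t) U :: real) \<le> real CARD('l)"
        by simp
    qed (auto simp: emeasure_eq_measure)
    finally show ?thesis
      using prob_space by simp
  qed
  have "\<not> 0 < prob (B 1)"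
  proof
    assume "0 < prob (B 1)"
    then obtain n where n: "real CARD('l) < real n * prob (B 1)"
      using reals_Archimedean3 by blast
    then have "n > 0"
      by (intro gr0I) auto
    then show False
      using bound[of n] n by simp
  qed
  then have "emeasure haar_unitary (B 1) = 0"
    using measure_nonneg[of haar_unitary "B 1"] by (simp add: emeasure_eq_measure)
  then show ?thesis
    using B[of 1] by (intro AE_I[of _ _ "B 1"]) (auto simp: B_def cscale_one)
qed

text \<open>The norm of K Y attains its maximum on the compact unit sphere, so the maximum is below
  1; homogeneity extends the bound.\<close>

lemma strict_contraction_uniform:
  fixes K :: "complex^'l^'l"
  assumes "\<And>Y :: complex^'l^'l. Y \<noteq> 0 \<Longrightarrow> norm (K ** Y) < norm Y"
  obtains q where "0 \<le> q" "q < 1" "\<And>Y :: complex^'l^'l. norm (K ** Y) \<le> q * norm Y"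
proof -
  have "continuous_on (sphere 0 1) (\<lambda>Y :: complex^'l^'l. norm (K ** Y))"
    by (intro continuous_intros)
  then have "\<exists>Y0\<in>sphere (0 :: complex^'l^'l) 1. \<forall>Y\<in>sphere (0 :: complex^'l^'l) 1. norm (K ** Y) \<le> norm (K ** Y0)"
    by (rule continuous_attains_sup[rotated 2]) simp_all
  then obtain Y0 :: "complex^'l^'l" where Y0: "Y0 \<in> sphere 0 1"
    and max: "\<And>Y :: complex^'l^'l. Y \<in> sphere 0 1 \<Longrightarrow> norm (K ** Y) \<le> norm (K ** Y0)"
    by blast
  have "norm (K ** Y) \<le> norm (K ** Y0) * norm Y" for Y :: "complex^'l^'l"
  proof (cases "Y = 0")
    case False
    then have "norm (K ** (inverse (norm Y) *\<^sub>R Y)) \<le> norm (K ** Y0)"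
      by (intro max) simp
    then have "inverse (norm Y) * norm (K ** Y) \<le> norm (K ** Y0)"
      by (simp add: matrix_scaleR_right)
    then show ?thesis
      using False by (simp add: field_simps)
  qed simp
  moreover have "norm (K ** Y0) < 1"
    using assms[of Y0] Y0 by (cases "Y0 = 0") auto
  ultimately show ?thesis
    using that[of "norm (K ** Y0)"] by simp
qed

text \<open>The Neumann series of the fixed point equation has only terms of positive degree in
  \<open>U\<^sup>*\<close>, which integrate to zero by invariance under phases.\<close>

lemma haar_integral_fixed_point:
  fixes D :: "complex^'l^'l \<Rightarrow> complex^'l^'l" and K X0 :: "complex^'l^'l"
  assumes contr: "\<And>Y :: complex^'l^'l. Y \<noteq> 0 \<Longrightarrow> norm (K ** Y) < norm Y"
    and D [measurable]: "D \<in> borel_measurable borel"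
    and fixed: "AE U in haar_unitary. D U = cadj U ** (X0 + K ** D U)"
  shows "integrable haar_unitary D" "(LINT U|haar_unitary. D U) = 0"
proof -
  interpret prob_space "haar_unitary :: (complex^'l^'l) measure"
    by (rule prob_space_haar)
  obtain q where q: "0 \<le> q" "q < 1" and K: "\<And>Y :: complex^'l^'l. norm (K ** Y) \<le> q * norm Y"
    using strict_contraction_uniform[OF contr] by metis
  \<comment> \<open>A priori bound: the equation gives norm D \<le> norm X0 + q norm D, which is
    solved for norm D.\<close>
  define C where "C = norm X0 / (1 - q)"
  \<comment> \<open>The k-th term of the Neumann series, homogeneous of degree k + 1 in the adjoint
    of U.\<close>
  define h where "h = rec_nat (\<lambda>U. cadj U ** X0) (\<lambda>k r U. cadj U ** (K ** r U))"
  have h0: "h 0 = (\<lambda>U. cadj U ** X0)"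
    and hSuc: "h (Suc k) = (\<lambda>U. cadj U ** (K ** h k U))" for k
    by (simp_all add: h_def)
  have h_meas [measurable]: "h k \<in> borel_measurable borel" for k
    by (induction k) (simp_all add: h0 hSuc)
  have h_scale: "h k (cscale \<omega> U) = cscale (cnj \<omega> ^ Suc k) (h k U)" for k \<omega> U
    by (induction k) (simp_all add: h0 hSuc cadj_simps matrix_ring_simps mult.commute)
  have AE_UD: "AE U in haar_unitary. unitary_mat U \<and> D U = cadj U ** (X0 + K ** D U)"
    using AE_haar_unitary fixed by eventually_elim simp
  have D_le: "norm (D U) \<le> C" if "unitary_mat U" "D U = cadj U ** (X0 + K ** D U)" for U
  proof -
    have "norm (D U) = norm (X0 + K ** D U)"
      using that(2) norm_unitary_mult[OF unitary_cadj[OF that(1)]] by metis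
    also have "\<dots> \<le> norm X0 + q * norm (D U)"
      using norm_triangle_ineq[of X0 "K ** D U"] K[of "D U"] by linarith
    finally show ?thesis
      using q by (simp add: C_def field_simps)
  qed
  have h_le: "norm (h k U) \<le> norm X0" if "unitary_mat U" for k U
  proof (induction k)
    case (Suc k)
    have "norm (h (Suc k) U) \<le> q * norm (h k U)"
      using K by (simp add: hSuc norm_unitary_mult[OF unitary_cadj[OF that]])
    also have "\<dots> \<le> 1 * norm X0"
      using Suc q by (intro mult_mono) auto
    finally show ?case
      by simp
  qed (simp add: h0 norm_unitary_mult[OF unitary_cadj[OF that]])
  have rem: "norm (D U - (\<Sum>k<n. h k U)) \<le> q ^ n * C"
    if U: "unitary_mat U" "D U = cadj U ** (X0 + K ** D U)" for U n
  proof (induction n)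
    case 0
    then show ?case
      using D_le[OF U] by simp
  next
    case (Suc n)
    \<comment> \<open>The term \<open>h 0\<close> cancels the inhomogeneity, so each remainder is
      \<open>cadj U ** K\<close> applied to the preceding one.\<close>
    have "D U - (\<Sum>k<Suc n. h k U) = cadj U ** (K ** (D U - (\<Sum>k<n. h k U)))"
      by (subst U(2), subst sum.lessThan_Suc_shift)
        (simp add: h0 hSuc matrix_ring_simps matrix_sum_ldistrib)
    then have "norm (D U - (\<Sum>k<Suc n. h k U)) \<le> q * norm (D U - (\<Sum>k<n. h k U))"
      using K by (simp add: norm_unitary_mult[OF unitary_cadj[OF U(1)]])
    also have "\<dots> \<le> q * (q ^ n * C)"
      using Suc q by (intro mult_left_mono)
    finally show ?case
      by simp
  qed
  show int_D: "integrable haar_unitary D"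
  proof (rule integrable_const_bound[where B = C])
    show "AE U in haar_unitary. norm (D U) \<le> C"
      using AE_UD by eventually_elim (blast intro: D_le)
  qed measurable
  have int_h: "integrable haar_unitary (h k)" for k
  proof (rule integrable_const_bound[where B = "norm X0"])
    show "AE U in haar_unitary. norm (h k U) \<le> norm X0"
      using AE_haar_unitary by eventually_elim (rule h_le)
  qed measurable
  have h_zero: "(LINT U|haar_unitary. h k U) = 0" for k
  \<comment> \<open>The phase is chosen so that its conjugate to the power k + 1, the degree of
    \<open>h k\<close>, is cis pi = -1.\<close>
  proof (rule haar_integral_odd[where \<omega> = "cis (- pi / Suc k)"])
    have "cnj (cis (- pi / Suc k)) ^ Suc k = cis (real (Suc k) * (pi / Suc k))"
      unfolding Complex.DeMoivre[symmetric] by (simp add: cis_cnj)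
    then have "cnj (cis (- pi / Suc k)) ^ Suc k = -1"
      by simp
    then show "h k (cscale (cis (- pi / Suc k)) U) = - h k U" for U
      unfolding h_scale by (simp only: cscale_neg cscale_one)
  qed (auto simp: norm_cis)
  have "norm (LINT U|haar_unitary. D U) \<le> q ^ n * C" for n
  proof -
    have "(LINT U|haar_unitary. D U) = (LINT U|haar_unitary. D U - (\<Sum>k<n. h k U))"
      using int_D int_h by (simp add: h_zero)
    also have "norm \<dots> \<le> (LINT U|haar_unitary. norm (D U - (\<Sum>k<n. h k U)))"
      by (rule integral_norm_bound)
    also have "\<dots> \<le> (LINT U :: complex^'l^'l|haar_unitary. q ^ n * C)"
    proof (rule integral_mono_AE)
      show "AE U in haar_unitary. norm (D U - (\<Sum>k<n. h k U)) \<le> q ^ n * C"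
        using AE_UD by eventually_elim (blast intro: rem)
    qed (use int_D int_h in auto)
    finally show ?thesis
      using prob_space by simp
  qed
  moreover have "(\<lambda>n. q ^ n * C) \<longlonglongrightarrow> 0 * C"
    using q by (intro tendsto_intros LIMSEQ_realpow_zero)
  ultimately have "norm (LINT U|haar_unitary. D U) \<le> 0 * C"
    by (intro LIMSEQ_le_const[of "\<lambda>n. q ^ n * C"]) auto
  then show "(LINT U|haar_unitary. D U) = 0"
    by simp
qed

section \<open>Transfer matrices and the Green function\<close>

lemma sum_UNIV_Plus: "sum f (UNIV :: ('a::finite + 'b::finite) set) = (\<Sum>a\<in>UNIV. f (Inl a)) + (\<Sum>b\<in>UNIV. f (Inr b))"
  by (subst UNIV_Plus_UNIV[symmetric], subst sum.Plus) simp_all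

lemma blk_mult:
  fixes X Y :: "complex^('l::finite + 'l)^('l + 'l)"
  shows "blk11 (X ** Y) = blk11 X ** blk11 Y + blk12 X ** blk21 Y"
    and "blk12 (X ** Y) = blk11 X ** blk12 Y + blk12 X ** blk22 Y"
    and "blk21 (X ** Y) = blk21 X ** blk11 Y + blk22 X ** blk21 Y"
    and "blk22 (X ** Y) = blk21 X ** blk12 Y + blk22 X ** blk22 Y"
  by (simp_all add: vec_eq_iff matrix_matrix_mult_def blk11_def blk12_def blk21_def blk22_def sum_UNIV_Plus)

lemma blk_one:
  "blk11 (mat 1 :: complex^('l::finite + 'l)^('l + 'l)) = mat 1"
  "blk12 (mat 1 :: complex^('l::finite + 'l)^('l + 'l)) = 0"
  "blk21 (mat 1 :: complex^('l::finite + 'l)^('l + 'l)) = 0"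
  "blk22 (mat 1 :: complex^('l::finite + 'l)^('l + 'l)) = mat 1"
  by (simp_all add: vec_eq_iff blk11_def blk12_def blk21_def blk22_def mat_def)

lemma blk_transfer:
  "blk11 (transfer N T V z n) = (mat z - V n) ** matrix_inv (Tfull N T n)"
  "blk12 (transfer N T V z n) = - cadj (Tfull N T n)"
  "blk21 (transfer N T V z n) = matrix_inv (Tfull N T n)"
  "blk22 (transfer N T V z n) = 0"
  by (simp_all add: vec_eq_iff blk11_def blk12_def blk21_def blk22_def transfer_def Let_def)

section \<open>Inverses of block matrices\<close>

lemma block_mult_assoc:
  "block_mult N (block_mult N P Q) R n m = block_mult N P (block_mult N Q R) n m"
proof -
  have "block_mult N (block_mult N P Q) R n m = (\<Sum>k\<in>{1..N}. \<Sum>j\<in>{1..N}. P n j ** (Q j k ** R k m))"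
    by (simp add: block_mult_def matrix_sum_rdistrib matrix_mul_assoc)
  also have "\<dots> = (\<Sum>j\<in>{1..N}. \<Sum>k\<in>{1..N}. P n j ** (Q j k ** R k m))"
    by (rule sum.swap)
  also have "\<dots> = block_mult N P (block_mult N Q R) n m"
    by (simp add: block_mult_def matrix_sum_ldistrib)
  finally show ?thesis .
qed

lemma block_mult_cong:
  assumes "\<And>k. k \<in> {1..N} \<Longrightarrow> P n k = P' n k" "\<And>k. k \<in> {1..N} \<Longrightarrow> Q k m = Q' k m"
  shows "block_mult N P Q n m = block_mult N P' Q' n m"
  using assms by (simp add: block_mult_def)

lemma block_mult_id:
  assumes "n \<in> {1..N}" "m \<in> {1..N}"
  shows "block_mult N block_id Q n m = Q n m" "block_mult N P block_id n m = P n m"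
proof -
  have "block_mult N block_id Q n m = (\<Sum>k\<in>{1..N}. if n = k then Q k m else 0)"
    unfolding block_mult_def block_id_def by (intro sum.cong) auto
  then show "block_mult N block_id Q n m = Q n m"
    using assms by simp
  have "block_mult N P block_id n m = (\<Sum>k\<in>{1..N}. if k = m then P n k else 0)"
    unfolding block_mult_def block_id_def by (intro sum.cong) auto
  then show "block_mult N P block_id n m = P n m"
    using assms by simp
qed

text \<open>The usual L = L (P X) = X, localized: only row n of L and column m of X enter, so
  solving for one column already fixes an entry of the inverse.\<close>

lemma block_left_inverse_eq:
  assumes L: "\<And>k. k \<in> {1..N} \<Longrightarrow> block_mult N L P n k = block_id n k"
    and X: "\<And>k. k \<in> {1..N} \<Longrightarrow> block_mult N P X k m = block_id k m"
    and nm: "n \<in> {1..N}" "m \<in> {1..N}"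
  shows "L n m = X n m"
proof -
  have "L n m = block_mult N L (block_mult N P X) n m"
    using block_mult_cong[of N L n L "block_mult N P X" m block_id] X
    by (simp add: block_mult_id[OF nm])
  also have "\<dots> = block_mult N (block_mult N L P) X n m"
    by (rule block_mult_assoc[symmetric])
  also have "\<dots> = X n m"
    using block_mult_cong[of N "block_mult N L P" n block_id X m X] L
    by (simp add: block_mult_id[OF nm])
  finally show ?thesis .
qed

lemma block_inv_eq:
  assumes L: "\<And>n m. n \<in> {1..N} \<Longrightarrow> m \<in> {1..N} \<Longrightarrow> block_mult N L P n m = block_id n m"
    and R: "\<And>n m. n \<in> {1..N} \<Longrightarrow> m \<in> {1..N} \<Longrightarrow> block_mult N P R n m = block_id n m"
    and nm: "n \<in> {1..N}" "m \<in> {1..N}"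
  shows "block_inv N P n m = R n m"
proof -
  \<comment> \<open>The description in \<open>block_inv\<close> prescribes zero blocks outside the
    index square, so R has to be truncated before it qualifies.\<close>
  define R' where "R' = (\<lambda>n m. if n \<in> {1..N} \<and> m \<in> {1..N} then R n m else 0)"
  have LR: "L n m = R n m" if "n \<in> {1..N}" "m \<in> {1..N}" for n m
    using L R that by (intro block_left_inverse_eq[of N L P n R m])
  have R'1: "block_mult N P R' n m = block_id n m" if "n \<in> {1..N}" "m \<in> {1..N}" for n m
    unfolding R[OF that, symmetric] using that by (intro block_mult_cong) (simp_all add: R'_def)
  have R'2: "block_mult N R' P n m = block_id n m" if "n \<in> {1..N}" "m \<in> {1..N}" for n m
    unfolding L[OF that, symmetric] using that by (intro block_mult_cong) (simp_all add: R'_def LR)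
  have "block_inv N P = R'"
    unfolding block_inv_def
  proof (rule the_equality)
    show "(\<forall>n m. n \<notin> {1..N} \<or> m \<notin> {1..N} \<longrightarrow> R' n m = 0) \<and>
      (\<forall>n\<in>{1..N}. \<forall>m\<in>{1..N}. block_mult N P R' n m = block_id n m \<and> block_mult N R' P n m = block_id n m)"
      using R'1 R'2 by (simp add: R'_def)
    fix S assume S: "(\<forall>n m. n \<notin> {1..N} \<or> m \<notin> {1..N} \<longrightarrow> S n m = 0) \<and>
      (\<forall>n\<in>{1..N}. \<forall>m\<in>{1..N}. block_mult N P S n m = block_id n m \<and> block_mult N S P n m = block_id n m)"
    show "S = R'"
    proof (intro ext)
      fix n m
      show "S n m = R' n m"
      proof (cases "n \<in> {1..N} \<and> m \<in> {1..N}")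
        case True
        with S R'1 show ?thesis
          by (intro block_left_inverse_eq[of N S P n R' m]) auto
      next
        case False
        with S show ?thesis
          by (auto simp: R'_def)
      qed
    qed
  qed
  then show ?thesis
    using nm by (simp add: R'_def)
qed

text \<open>Pairing with i Y extracts the imaginary part of the trace of Y^* Z Y, which is real for
  self-adjoint Z.\<close>

lemma inner_i_self_adjoint:
  assumes "self_adjoint_mat Z"
  shows "inner (cscale \<i> Y) (Z ** Y) = 0"
proof -
  have "inner (cscale \<i> Y) (Z ** Y) = - inner (Z ** Y) (cscale \<i> Y)"
    using assms inner_matrix_mult_left[of Z Y "cscale \<i> Y"]
    by (simp add: self_adjoint_mat_def cscale_mult_right inner_cscale_i_left)
  then show ?thesis
    by (simp add: inner_commute)
qed

lemma inner_i_cscale: "inner (cscale \<i> Y) (cscale z Y) = Im z * (norm Y)\<^sup>2"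
proof -
  have "cscale (of_real r + \<i> * of_real s) Y = r *\<^sub>R Y + s *\<^sub>R cscale \<i> Y" for r s
    by (simp add: vec_eq_iff) (simp add: scaleR_conv_of_real algebra_simps)
  then have "cscale z Y = Re z *\<^sub>R Y + Im z *\<^sub>R cscale \<i> Y"
    by (metis complex_eq)
  moreover have "inner (cscale \<i> Y) Y = 0"
    using inner_i_self_adjoint[of "mat 1" Y] by (simp add: self_adjoint_mat_def)
  ultimately show ?thesis
    by (simp add: inner_add_right inner_cscale_i power2_norm_eq_inner)
qed

section \<open>Solutions of the three-term recursion\<close>

locale jacobi_chain =
  fixes N :: nat and T V :: "nat \<Rightarrow> complex^'l^'l"
  assumes N_pos: "N \<ge> 1"
    and T_inv: "\<And>n. n \<in> {2..N} \<Longrightarrow> invertible (T n)"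
    and V_sa: "\<And>n. n \<in> {1..N} \<Longrightarrow> self_adjoint_mat (V n)"
begin

abbreviation "t \<equiv> Tfull N T"
text \<open>Partial products are kept because \<open>c z n\<close> and \<open>d z n\<close> are the
  matrix solutions at site n, with initial values 0, 1 and 1, 0 at the sites 0 and 1. For n < N,
  \<open>a z n\<close> is \<open>t (Suc n) ** c z (Suc n)\<close>, and likewise \<open>b\<close>
  belongs to \<open>d\<close>.\<close>

definition "a z n = blk11 (transfer_prod N T V z n)"
definition "b z n = blk12 (transfer_prod N T V z n)"
definition "c z n = blk21 (transfer_prod N T V z n)"
definition "d z n = blk22 (transfer_prod N T V z n)"

lemma t_one: "t 1 = mat 1"
  by (simp add: Tfull_def)

lemma t_inv: "n \<in> {1..N} \<Longrightarrow> invertible (t n)"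
  using T_inv[of n] invertible_right_inverse[of "mat 1 :: complex^'l^'l"]
  by (auto simp: Tfull_def intro: exI[of _ "mat 1"])

lemma t_inv_right: "n \<in> {1..N} \<Longrightarrow> t n ** (matrix_inv (t n) ** X) = X"
  using matrix_inv_right[OF t_inv] by (simp add: matrix_mul_assoc)

lemma cadj_t_inv: "n \<in> {1..N} \<Longrightarrow> cadj (matrix_inv (t n)) ** (cadj (t n) ** X) = X"
  using matrix_inv_right[OF t_inv] by (simp add: matrix_mul_assoc cadj_mult[symmetric])

lemma cadj_V: "n \<in> {1..N} \<Longrightarrow> cadj (V n) = V n"
  using V_sa by (simp add: self_adjoint_mat_def)

lemma transfer_0: "a z 0 = mat 1" "b z 0 = 0" "c z 0 = 0" "d z 0 = mat 1"
  by (simp_all add: a_def b_def c_def d_def blk_one)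

lemma transfer_Suc:
  "c z (Suc n) = matrix_inv (t (Suc n)) ** a z n"
  "d z (Suc n) = matrix_inv (t (Suc n)) ** b z n"
  "a z (Suc n) = cscale z (c z (Suc n)) - V (Suc n) ** c z (Suc n) - cadj (t (Suc n)) ** c z n"
  "b z (Suc n) = cscale z (d z (Suc n)) - V (Suc n) ** d z (Suc n) - cadj (t (Suc n)) ** d z n"
  by (simp_all add: a_def b_def c_def d_def blk_mult blk_transfer matrix_ring_simps)

text \<open>The left side is the imaginary part of the trace of (c X)^* a X. In one step of the
  recursion V drops out by self-adjointness, the hopping term returns the value at the preceding
  site, and z contributes the new summand.\<close>

lemma wronskian:
  fixes X :: "complex^'l^'l"
  assumes "n \<le> N"
  shows "inner (cscale \<i> (c z n ** X)) (a z n ** X) = Im z * (\<Sum>k\<in>{1..n}. (norm (c z k ** X))\<^sup>2)"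
  using assms
proof (induction n)
  case 0
  then show ?case
    by (simp add: transfer_0 cscale_zero)
next
  case (Suc n)
  define Y where "Y = c z (Suc n) ** X"
  have n: "Suc n \<in> {1..N}"
    using Suc.prems by simp
  have aX: "a z (Suc n) ** X = cscale z Y - V (Suc n) ** Y - cadj (t (Suc n)) ** (c z n ** X)"
    by (simp add: transfer_Suc(3) Y_def matrix_ring_simps)
  have tY: "t (Suc n) ** Y = a z n ** X"
    by (simp add: Y_def transfer_Suc(1) matrix_mul_assoc[symmetric] t_inv_right[OF n])
  have "inner (cscale \<i> Y) (cadj (t (Suc n)) ** (c z n ** X)) = inner (cscale \<i> (a z n ** X)) (c z n ** X)"
    by (simp add: inner_matrix_mult_left[symmetric] cscale_mult_right tY)
  also have "\<dots> = - inner (cscale \<i> (c z n ** X)) (a z n ** X)"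
    using inner_cscale_i_left[of "a z n ** X" "c z n ** X"] by (simp only: inner_commute)
  finally have "inner (cscale \<i> Y) (a z (Suc n) ** X)
      = Im z * (norm Y)\<^sup>2 + inner (cscale \<i> (c z n ** X)) (a z n ** X)"
    unfolding aX by (simp add: inner_diff_right inner_i_cscale inner_i_self_adjoint V_sa[OF n])
  then show ?case
    using Suc by (simp add: Y_def algebra_simps)
qed

lemma c_one: "c z (Suc 0) = mat 1"
  using matrix_inv_unique(2)[of "mat 1 :: complex^'l^'l" "mat 1"] t_one
  by (simp add: transfer_Suc(1) transfer_0)

lemma d_one: "d z (Suc 0) = 0"
  by (simp add: transfer_Suc(2) transfer_0)

text \<open>The summand k = 1, where \<open>c z 1\<close> is the identity, makes the Wronskian sum
  positive definite.\<close>

lemma sum_norm_c_ge: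
  fixes X :: "complex^'l^'l"
  shows "(norm X)\<^sup>2 \<le> (\<Sum>k\<in>{1..N}. (norm (c z k ** X))\<^sup>2)"
proof -
  have "(norm (c z 1 ** X))\<^sup>2 \<le> (\<Sum>k\<in>{1..N}. (norm (c z k ** X))\<^sup>2)"
    using N_pos by (intro member_le_sum) auto
  then show ?thesis
    by (simp add: c_one)
qed

text \<open>Polarization turns the Wronskian into the difference of the two boundary norms.\<close>

lemma norm_boundary_diff:
  fixes X :: "complex^'l^'l"
  shows "(norm ((a z N + cscale \<i> (c z N)) ** X))\<^sup>2 - (norm ((a z N - cscale \<i> (c z N)) ** X))\<^sup>2
    = 4 * (Im z * (\<Sum>k\<in>{1..N}. (norm (c z k ** X))\<^sup>2))"
proof -
  have polar: "(norm (P + Q))\<^sup>2 - (norm (P - Q))\<^sup>2 = 4 * inner Q P" for P Q :: "complex^'l^'l"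
    unfolding power2_norm_eq_inner inner_add_left inner_add_right inner_diff_left inner_diff_right
    using inner_commute[of P Q] by linarith
  have "(a z N + cscale \<i> (c z N)) ** X = a z N ** X + cscale \<i> (c z N ** X)"
    "(a z N - cscale \<i> (c z N)) ** X = a z N ** X - cscale \<i> (c z N ** X)"
    by (simp_all add: matrix_ring_simps)
  then show ?thesis
    by (simp only: polar wronskian[OF order_refl])
qed

lemma norm_boundary_less:
  fixes X :: "complex^'l^'l"
  assumes "Im z > 0" "X \<noteq> 0"
  shows "norm ((a z N - cscale \<i> (c z N)) ** X) < norm ((a z N + cscale \<i> (c z N)) ** X)"
proof -
  have "0 < (norm X)\<^sup>2"
    using assms by simp
  then have "0 < (\<Sum>k\<in>{1..N}. (norm (c z k ** X))\<^sup>2)"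
    using sum_norm_c_ge[of X z] by linarith
  then have "0 < Im z * (\<Sum>k\<in>{1..N}. (norm (c z k ** X))\<^sup>2)"
    by (rule mult_pos_pos[OF assms(1)])
  then have "(norm ((a z N - cscale \<i> (c z N)) ** X))\<^sup>2 < (norm ((a z N + cscale \<i> (c z N)) ** X))\<^sup>2"
    using norm_boundary_diff[of z X] by linarith
  then show ?thesis
    by (rule power2_less_imp_less) simp
qed

text \<open>A kernel element would give a solution satisfying both boundary conditions.
  Self-adjointness of Z makes its Wronskian vanish, against Im z \<noteq> 0.\<close>

lemma invertible_boundary:
  assumes "self_adjoint_mat Z" "Im z \<noteq> 0"
  shows "invertible (a z N + Z ** c z N)"
proof (rule invertible_if_injective)
  fix X :: "complex^'l^'l"
  assume "(a z N + Z ** c z N) ** X = 0"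
  then have "a z N ** X = - (Z ** (c z N ** X))"
    by (simp add: matrix_ring_simps add_eq_0_iff2)
  then have "Im z * (\<Sum>k\<in>{1..N}. (norm (c z k ** X))\<^sup>2) = 0"
    using wronskian[of N z X] inner_i_self_adjoint[OF assms(1), of "c z N ** X"] by simp
  then show "X = 0"
    using sum_norm_c_ge[of X z] assms(2) by simp
qed

lemma invertible_plus_i: "Im z > 0 \<Longrightarrow> invertible (a z N + cscale \<i> (c z N))"
  using norm_boundary_less by (intro invertible_if_injective) (metis norm_not_less_zero norm_zero)

text \<open>In the lower half plane the two boundary combinations exchange roles. At
  \<open>cnj z\<close> the adjoint of this matrix is the denominator of the second formula for the
  average.\<close>

lemma invertible_minus_i:
  assumes "Im z < 0"
  shows "invertible (a z N - cscale \<i> (c z N))"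
proof (rule invertible_if_injective)
  fix X :: "complex^'l^'l"
  assume "(a z N - cscale \<i> (c z N)) ** X = 0"
  then have "0 \<le> Im z * (\<Sum>k\<in>{1..N}. (norm (c z k ** X))\<^sup>2)"
    using norm_boundary_diff[of z X] zero_le_power2[of "norm ((a z N + cscale \<i> (c z N)) ** X)"]
    by (simp only: norm_zero zero_power2)
  then have "(\<Sum>k\<in>{1..N}. (norm (c z k ** X))\<^sup>2) \<le> 0"
    using assms by (simp add: zero_le_mult_iff)
  then have "(norm X)\<^sup>2 \<le> 0"
    using sum_norm_c_ge[of X z] by linarith
  then show "X = 0"
    by simp
qed

text \<open>Runs the recursion backwards, by invertibility of the hopping matrices, down to
  \<open>a z 0 = mat 1\<close>. It replaces the Wronskian bound at real energies.\<close>

lemma transfer_kernel: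
  fixes X :: "complex^'l^'l"
  assumes "n \<le> N" "a z n ** X = 0" "c z n ** X = 0"
  shows "X = 0"
  using assms
proof (induction n)
  case 0
  then show ?case
    by (simp add: transfer_0)
next
  case (Suc n)
  then have n: "Suc n \<in> {1..N}" by simp
  have "t (Suc n) ** (c z (Suc n) ** X) = 0"
    using Suc.prems by simp
  then have aX: "a z n ** X = 0"
    by (simp add: transfer_Suc(1) matrix_mul_assoc[symmetric] t_inv_right[OF n])
  have "a z (Suc n) ** X = cscale z (c z (Suc n) ** X) - V (Suc n) ** (c z (Suc n) ** X) - cadj (t (Suc n)) ** (c z n ** X)"
    by (simp add: transfer_Suc(3) matrix_ring_simps)
  then have "cadj (t (Suc n)) ** (c z n ** X) = 0"
    using Suc.prems by (simp add: cscale_zero)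
  then have "c z n ** X = 0"
    using cadj_t_inv[OF n, of "c z n ** X"] by simp
  then show ?case
    using Suc aX by simp
qed

text \<open>At real energy the Wronskian vanishes, so a X and i c X are orthogonal; by Pythagoras
  both are zero on the kernel.\<close>

lemma invertible_plus_i_real: "invertible (a (of_real E) N + cscale \<i> (c (of_real E) N))"
proof (rule invertible_if_injective)
  fix X :: "complex^'l^'l"
  let ?a = "a (of_real E) N ** X" and ?c = "c (of_real E) N ** X"
  assume "(a (of_real E) N + cscale \<i> (c (of_real E) N)) ** X = 0"
  then have "?a + cscale \<i> ?c = 0"
    by (simp add: matrix_ring_simps)
  moreover have "inner (cscale \<i> ?c) ?a = 0"
    using wronskian[of N "of_real E" X] by simp
  moreover have "(norm (?a + cscale \<i> ?c))\<^sup>2 = (norm ?a)\<^sup>2 + (norm ?c)\<^sup>2 + 2 * inner (cscale \<i> ?c) ?a"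
    by (simp add: power2_norm_eq_inner inner_add_left inner_add_right inner_cscale_i inner_commute)
  ultimately have "(norm ?a)\<^sup>2 + (norm ?c)\<^sup>2 = 0"
    by simp
  then have "?a = 0" "?c = 0"
    by (simp_all add: sum_power2_eq_zero_iff)
  then show "X = 0"
    using transfer_kernel[of N] by blast
qed

text \<open>The Wronskian of the solutions at z and \<open>cnj z\<close> is constant in n and starts
  at zero. At real energy this removes the cross terms of P^* P.\<close>

lemma transfer_cadj_a_c:
  assumes "n \<le> N"
  shows "cadj (a (cnj z) n) ** c z n = cadj (c (cnj z) n) ** a z n"
  using assms
proof (induction n)
  case 0
  then show ?case
    by (simp add: transfer_0)
next
  case (Suc n)
  then have n: "Suc n \<in> {1..N}" by simp
  have "cadj (c (cnj z) n) ** (t (Suc n) ** c z (Suc n)) = cadj (t (Suc n) ** c (cnj z) (Suc n)) ** c z n"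
    using Suc by (simp add: transfer_Suc(1) t_inv_right[OF n])
  then show ?case
    by (simp add: transfer_Suc(3) cadj_simps matrix_ring_simps cadj_V[OF n])
qed

text \<open>Blockwise form of M J M'^* = J, where M and M' are the partial products at z and
  \<open>cnj z\<close> and J is the standard symplectic matrix. The induction has to carry all four
  relations together.\<close>

lemma transfer_symplectic:
  assumes "n \<le> N"
  shows "b z n ** cadj (a (cnj z) n) = a z n ** cadj (b (cnj z) n) \<and>
    d z n ** cadj (c (cnj z) n) = c z n ** cadj (d (cnj z) n) \<and>
    a z n ** cadj (d (cnj z) n) - b z n ** cadj (c (cnj z) n) = mat 1 \<and>
    d z n ** cadj (a (cnj z) n) - c z n ** cadj (b (cnj z) n) = mat 1"
  using assms
proof (induction n)
  case 0
  then show ?case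
    by (simp add: transfer_0)
next
  case (Suc n)
  then have n: "Suc n \<in> {1..N}" by simp
  define v ti s where "v = V (Suc n)" and "ti = matrix_inv (t (Suc n))" and "s = t (Suc n)"
  define A B C D where "A = a z n" and "B = b z n" and "C = c z n" and "D = d z n"
  define A' B' C' D' where "A' = a z (Suc n)" and "B' = b z (Suc n)"
    and "C' = c z (Suc n)" and "D' = d z (Suc n)"
  \<comment> \<open>The suffix \<open>t\<close> marks adjoints at \<open>cnj z\<close>, the prime
    the next site. Double conjugation makes the same z appear in both recursions.\<close>
  define At Bt Ct Dt where "At = cadj (a (cnj z) n)" and "Bt = cadj (b (cnj z) n)"
    and "Ct = cadj (c (cnj z) n)" and "Dt = cadj (d (cnj z) n)"
  define At' Bt' Ct' Dt' where "At' = cadj (a (cnj z) (Suc n))" and "Bt' = cadj (b (cnj z) (Suc n))"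
    and "Ct' = cadj (c (cnj z) (Suc n))" and "Dt' = cadj (d (cnj z) (Suc n))"
  have IH: "B ** At = A ** Bt" "D ** Ct = C ** Dt" "A ** Dt - B ** Ct = mat 1" "D ** At - C ** Bt = mat 1"
    using Suc by (simp_all add: A_def B_def C_def D_def At_def Bt_def Ct_def Dt_def)
  have step: "C' = ti ** A" "D' = ti ** B"
    "A' = cscale z C' - v ** C' - cadj s ** C" "B' = cscale z D' - v ** D' - cadj s ** D"
    by (simp_all add: A_def B_def C_def D_def A'_def B'_def C'_def D'_def v_def ti_def s_def transfer_Suc)
  have stept: "Ct' = At ** cadj ti" "Dt' = Bt ** cadj ti"
    "At' = cscale z Ct' - Ct' ** v - Ct ** s" "Bt' = cscale z Dt' - Dt' ** v - Dt ** s"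
    by (simp_all add: At_def Bt_def Ct_def Dt_def At'_def Bt'_def Ct'_def Dt'_def v_def ti_def s_def
        transfer_Suc cadj_simps cadj_V[OF n])
  have s: "ti ** s = mat 1" "cadj s ** cadj ti = mat 1"
    using matrix_inv_left[OF t_inv[OF n]] by (simp_all add: ti_def s_def cadj_mult[symmetric])
  have 2: "D' ** Ct' = C' ** Dt'"
  proof -
    have "D' ** Ct' = ti ** ((B ** At) ** cadj ti)" "C' ** Dt' = ti ** ((A ** Bt) ** cadj ti)"
      by (simp_all only: step stept matrix_mul_assoc)
    then show ?thesis
      by (simp only: IH(1))
  qed
  \<comment> \<open>This relation, and \<open>f\<close> further down, pair blocks at site n with
    adjoint blocks at site n + 1; the hopping term produces exactly such pairings.\<close>
  have e: "D ** Ct' - C ** Dt' = cadj ti"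
  proof -
    have "D ** Ct' - C ** Dt' = (D ** At - C ** Bt) ** cadj ti"
      by (simp add: stept matrix_ring_simps)
    then show ?thesis
      by (simp add: IH)
  qed
  have 3: "A' ** Dt' - B' ** Ct' = mat 1"
  proof -
    have "A' ** Dt' - B' ** Ct' = cscale z (C' ** Dt' - D' ** Ct') - v ** (C' ** Dt' - D' ** Ct')
        + cadj s ** (D ** Ct' - C ** Dt')"
      by (simp add: step(3,4) matrix_ring_simps)
    then show ?thesis
      by (simp add: 2 e s cscale_zero)
  qed
  have 4: "D' ** At' - C' ** Bt' = mat 1"
  proof -
    have "D' ** At' - C' ** Bt' = cscale z (D' ** Ct' - C' ** Dt') - (D' ** Ct' - C' ** Dt') ** v
        + ti ** ((A ** Dt - B ** Ct) ** s)"
      by (simp add: stept(3,4) matrix_ring_simps) (simp add: step(1,2) matrix_ring_simps)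
    then show ?thesis
      by (simp add: 2 IH s cscale_zero)
  qed
  have 1: "B' ** At' = A' ** Bt'"
  proof -
    have "D ** At' - C ** Bt' = cscale z (D ** Ct' - C ** Dt') - (D ** Ct' - C ** Dt') ** v
        - (D ** Ct - C ** Dt) ** s"
      by (simp add: stept(3,4) matrix_ring_simps)
    then have f: "D ** At' - C ** Bt' = cscale z (cadj ti) - cadj ti ** v"
      by (simp add: e IH)
    have "B' ** At' - A' ** Bt' = cscale z (D' ** At' - C' ** Bt') - v ** (D' ** At' - C' ** Bt')
        - cadj s ** (D ** At' - C ** Bt')"
      by (simp add: step(3,4) matrix_ring_simps)
    also have "\<dots> = cscale z (mat 1) - v - (cscale z (cadj s ** cadj ti) - cadj s ** cadj ti ** v)"
      unfolding f 4 by (simp add: matrix_ring_simps)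
    finally show ?thesis
      by (simp add: s)
  qed
  from 1 2 3 4 show ?case
    by (simp add: A'_def B'_def C'_def D'_def At'_def Bt'_def Ct'_def Dt'_def)
qed

section \<open>The resolvent of the block tridiagonal matrix\<close>

definition "Hz z Z n m = H_block N T V Z n m - (if n = m then mat z else 0)"

lemma Hz_row_sum:
  assumes "n \<in> {1..N}"
  shows "(\<Sum>k\<in>{1..N}. Hz z Z n k ** X k)
    = (if n = 1 then 0 else cadj (t n) ** X (n - 1)) + V n ** X n - cscale z (X n)
      + (if n = N then - (Z ** X n) else t (n + 1) ** X (n + 1))"
proof -
  \<comment> \<open>One indicator per band. At n = 1 the index n - 1 is 0 and at n = N the index n +
    1 is N + 1; both lie outside the range and drop out.\<close>
  have "(\<Sum>k\<in>{1..N}. Hz z Z n k ** X k) = (\<Sum>k\<in>{1..N}.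
      (if k = n - 1 then if n = 1 then 0 else cadj (t n) ** X (n - 1) else 0)
      + (if k = n then V n ** X n - cscale z (X n) - (if n = N then Z ** X n else 0) else 0)
      + (if k = n + 1 then t (n + 1) ** X (n + 1) else 0))"
  proof (rule sum.cong[OF refl])
    fix k assume k: "k \<in> {1..N}"
    consider "k = n - 1" "n \<noteq> 1" | "k = n" | "k = n + 1" | "k + 1 \<noteq> n" "k \<noteq> n" "k \<noteq> n + 1"
      using k by force
    then show "Hz z Z n k ** X k
      = (if k = n - 1 then if n = 1 then 0 else cadj (t n) ** X (n - 1) else 0)
      + (if k = n then V n ** X n - cscale z (X n) - (if n = N then Z ** X n else 0) else 0)
      + (if k = n + 1 then t (n + 1) ** X (n + 1) else 0)"
      using k assms by cases (auto simp: Hz_def H_block_def Tfull_def matrix_ring_simps)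
  qed
  also have "\<dots> = (if n = 1 then 0 else cadj (t n) ** X (n - 1)) + V n ** X n - cscale z (X n)
      + (if n = N then - (Z ** X n) else t (n + 1) ** X (n + 1))"
    unfolding sum.distrib using assms by auto
  finally show ?thesis .
qed

text \<open>The shooting method: \<open>\<phi> n\<close> stands for \<open>T\<^bsub>n+1\<^esub> \<psi>\<^bsub>n+1\<^esub>\<close>, and the right boundary
  condition is \<open>\<phi> N = - Z \<psi>\<^bsub>N\<^esub>\<close>.\<close>

lemma Hz_shooting:
  assumes "\<And>n. n < N \<Longrightarrow> t (Suc n) ** \<psi> (Suc n) = \<phi> n"
    and "\<And>n. n < N \<Longrightarrow> \<phi> (Suc n) = cscale z (\<psi> (Suc n)) - V (Suc n) ** \<psi> (Suc n)
        - cadj (t (Suc n)) ** \<psi> n + F (Suc n)"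
    and "\<phi> N = - (Z ** \<psi> N)" and "n \<in> {1..N}"
  shows "(\<Sum>k\<in>{1..N}. Hz z Z n k ** \<psi> k) = F n - (if n = 1 then \<psi> 0 else 0)"
proof -
  obtain m where m: "n = Suc m" "m < N"
    using assms(4) by (cases n) auto
  have "(if n = N then - (Z ** \<psi> n) else t (n + 1) ** \<psi> (n + 1)) = \<phi> n"
    using assms(1)[of n] assms(3) assms(4) by auto
  \<comment> \<open>Since \<open>t 1\<close> is the identity, the recursion at n = 1 contains
    \<open>\<psi> 0\<close>, which the matrix row lacks; hence the extra source.\<close>
  then show ?thesis
    unfolding Hz_row_sum[OF assms(4)] using assms(2)[OF m(2)] m t_one
    by auto
qed

text \<open>Linear shooting: \<open>u\<close>, \<open>w\<close> is the particular solution started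
  from zero, a multiple \<open>g\<close> of the homogeneous solution is added, and
  \<open>invertible_boundary\<close> fits \<open>g\<close> to the right boundary condition.\<close>

lemma Hz_solvable:
  fixes F :: "nat \<Rightarrow> complex^'l^'l"
  assumes Z: "self_adjoint_mat Z" and z: "Im z \<noteq> 0"
  shows "\<exists>X :: nat \<Rightarrow> complex^'l^'l. \<forall>n\<in>{1..N}. (\<Sum>k\<in>{1..N}. Hz z Z n k ** X k) = F n"
proof -
  define p where "p = rec_nat (0, 0) (\<lambda>n r. let y = matrix_inv (t (Suc n)) ** fst r in
    (cscale z y - V (Suc n) ** y - cadj (t (Suc n)) ** snd r + F (Suc n), y))"
  define u w where "u = (\<lambda>n. fst (p n))" and "w = (\<lambda>n. snd (p n))"
  have 0: "u 0 = 0" "w 0 = 0"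
    and Suc_w: "w (Suc n) = matrix_inv (t (Suc n)) ** u n"
    and Suc_u: "u (Suc n) = cscale z (w (Suc n)) - V (Suc n) ** w (Suc n) - cadj (t (Suc n)) ** w n + F (Suc n)" for n
    by (simp_all add: u_def w_def p_def Let_def)
  define g where "g = - (matrix_inv (a z N + Z ** c z N) ** (u N + Z ** w N))"
  have g: "(a z N + Z ** c z N) ** g = - (u N + Z ** w N)"
    unfolding g_def by (simp add: matrix_mult_minus_right matrix_mul_assoc matrix_inv_right[OF invertible_boundary[OF Z z]])
  define \<phi> \<psi> where "\<phi> = (\<lambda>n. a z n ** g + u n)" and "\<psi> = (\<lambda>n. c z n ** g + w n)"
  have "(\<Sum>k\<in>{1..N}. Hz z Z n k ** \<psi> k) = F n - (if n = 1 then \<psi> 0 else 0)" if "n \<in> {1..N}" for n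
  proof (rule Hz_shooting[OF _ _ _ that])
    fix n assume "n < N"
    then have n: "Suc n \<in> {1..N}" by simp
    show "t (Suc n) ** \<psi> (Suc n) = \<phi> n"
      by (simp add: \<phi>_def \<psi>_def Suc_w transfer_Suc(1) matrix_ring_simps t_inv_right[OF n])
    show "\<phi> (Suc n) = cscale z (\<psi> (Suc n)) - V (Suc n) ** \<psi> (Suc n) - cadj (t (Suc n)) ** \<psi> n + F (Suc n)"
      by (simp add: \<phi>_def \<psi>_def Suc_u transfer_Suc(3) matrix_ring_simps)
  next
    show "\<phi> N = - (Z ** \<psi> N)"
      using g by (simp add: \<phi>_def \<psi>_def matrix_ring_simps) (simp add: algebra_simps eq_neg_iff_add_eq_0)
  qed
  moreover have "\<psi> 0 = 0"
    by (simp add: \<psi>_def 0 transfer_0)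
  ultimately show ?thesis
    by (intro exI[of _ \<psi>]) simp
qed

lemma Hz_right_inverse:
  assumes "self_adjoint_mat Z" "Im z \<noteq> 0"
  obtains R where "\<And>n m. n \<in> {1..N} \<Longrightarrow> block_mult N (Hz z Z) R n m = block_id n m"
proof -
  have "\<forall>m. \<exists>X :: nat \<Rightarrow> complex^'l^'l. \<forall>n\<in>{1..N}. (\<Sum>k\<in>{1..N}. Hz z Z n k ** X k) = block_id n m"
    by (intro allI Hz_solvable[OF assms])
  then obtain X :: "nat \<Rightarrow> nat \<Rightarrow> complex^'l^'l" where "\<forall>m. \<forall>n\<in>{1..N}. (\<Sum>k\<in>{1..N}. Hz z Z n k ** X m k) = block_id n m"
    by metis
  then show ?thesis
    by (intro that[of "\<lambda>k m. X m k"]) (simp add: block_mult_def)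
qed

lemma cadj_Hz:
  assumes "self_adjoint_mat Z" "n \<in> {1..N}" "m \<in> {1..N}"
  shows "cadj (Hz (cnj z) Z n m) = Hz z Z m n"
  using assms cadj_V[OF assms(2)] cadj_V[of N]
  by (auto simp: Hz_def H_block_def cadj_simps cadj_mat self_adjoint_mat_def)

text \<open>The matrix at z is the adjoint of the one at \<open>cnj z\<close>, so the adjoint of a
  right inverse there is a left inverse here.\<close>

lemma Hz_left_inverse:
  assumes Z: "self_adjoint_mat Z" and "Im z \<noteq> 0"
  obtains L where "\<And>n m. m \<in> {1..N} \<Longrightarrow> block_mult N L (Hz z Z) n m = block_id n m"
proof -
  obtain R where R: "\<And>n m. n \<in> {1..N} \<Longrightarrow> block_mult N (Hz (cnj z) Z) R n m = block_id n m"
    using Hz_right_inverse[OF Z, of "cnj z"] assms(2) by auto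
  have "block_mult N (\<lambda>n m. cadj (R m n)) (Hz z Z) n m = block_id n m" if "m \<in> {1..N}" for n m
  proof -
    have "block_mult N (\<lambda>n m. cadj (R m n)) (Hz z Z) n m = cadj (block_mult N (Hz (cnj z) Z) R m n)"
      using that by (auto simp: block_mult_def cadj_sum cadj_mult cadj_Hz[OF Z] intro!: sum.cong)
    also have "\<dots> = block_id n m"
      by (simp add: R[OF that] block_id_def)
    finally show ?thesis .
  qed
  then show ?thesis
    by (rule that)
qed

text \<open>The first block column of the resolvent is c g - d: it takes the value -1 at site 0, so
  its source is the identity in the first block, and its value at site 1 is g.\<close>

lemma block_inv_Hz:
  assumes Z: "self_adjoint_mat Z" and z: "Im z \<noteq> 0"
  shows "(a z N + Z ** c z N) ** block_inv N (Hz z Z) 1 1 = b z N + Z ** d z N"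
proof -
  obtain R where R: "\<And>n m. n \<in> {1..N} \<Longrightarrow> block_mult N (Hz z Z) R n m = block_id n m"
    using Hz_right_inverse[OF assms] by blast
  obtain L where L: "\<And>n m. m \<in> {1..N} \<Longrightarrow> block_mult N L (Hz z Z) n m = block_id n m"
    using Hz_left_inverse[OF assms] by blast
  define g where "g = matrix_inv (a z N + Z ** c z N) ** (b z N + Z ** d z N)"
  have g: "(a z N + Z ** c z N) ** g = b z N + Z ** d z N"
    unfolding g_def by (simp add: matrix_mul_assoc matrix_inv_right[OF invertible_boundary[OF assms]])
  define \<phi> \<psi> where "\<phi> = (\<lambda>n. a z n ** g - b z n)" and "\<psi> = (\<lambda>n. c z n ** g - d z n)"
  have \<psi>: "(\<Sum>k\<in>{1..N}. Hz z Z n k ** \<psi> k) = 0 - (if n = 1 then \<psi> 0 else 0)" if "n \<in> {1..N}" for n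
  proof (rule Hz_shooting[OF _ _ _ that, where F = "\<lambda>_. 0"])
    fix n assume "n < N"
    then have n: "Suc n \<in> {1..N}" by simp
    show "t (Suc n) ** \<psi> (Suc n) = \<phi> n"
      by (simp add: \<phi>_def \<psi>_def transfer_Suc(1,2) matrix_ring_simps t_inv_right[OF n])
    show "\<phi> (Suc n) = cscale z (\<psi> (Suc n)) - V (Suc n) ** \<psi> (Suc n) - cadj (t (Suc n)) ** \<psi> n + 0"
      by (simp add: \<phi>_def \<psi>_def transfer_Suc(3,4) matrix_ring_simps)
  next
    show "\<phi> N = - (Z ** \<psi> N)"
      using g by (simp add: \<phi>_def \<psi>_def matrix_ring_simps) (simp add: algebra_simps)
  qed
  have \<psi>_0: "\<psi> 0 = - mat 1"
    by (simp add: \<psi>_def transfer_0)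
  have "block_mult N (Hz z Z) (\<lambda>k m. \<psi> k) n 1 = block_id n 1" if "n \<in> {1..N}" for n
    using \<psi>[OF that] by (simp add: block_mult_def block_id_def \<psi>_0)
  then have "L 1 1 = \<psi> 1"
    using N_pos L by (intro block_left_inverse_eq[of N L "Hz z Z" 1 "\<lambda>k m. \<psi> k" 1]) auto
  moreover have "L 1 1 = R 1 1"
    using N_pos L R by (intro block_left_inverse_eq[of N L "Hz z Z" 1 R 1]) auto
  moreover have "block_inv N (Hz z Z) 1 1 = R 1 1"
    using N_pos L R by (intro block_inv_eq[of N L]) auto
  moreover have "\<psi> 1 = g"
    by (simp add: \<psi>_def c_one d_one)
  ultimately show ?thesis
    using g by simp
qed

lemma G_N_eq: "G_N N T V z U = block_inv N (Hz z (cayley_Z U)) 1 1"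
  by (simp add: G_N_def Hz_def[abs_def])

end

section \<open>Averaging the Green function\<close>

lemma mat_Im_eq: "mat_Im X = cscale (1 / (2 * \<i>)) (X - cadj X)"
  by (simp add: vec_eq_iff mat_Im_def)

lemma bounded_linear_mat_Im: "bounded_linear (mat_Im :: complex^'l^'l \<Rightarrow> _)"
  unfolding mat_Im_eq[abs_def]
  by (intro bounded_linear_compose[OF bounded_linear_cscale] bounded_linear_sub
      bounded_linear_ident bounded_linear_cadj)

lemma continuous_on_cscale_mult:
  fixes g :: "'a::topological_space \<Rightarrow> complex^'l^'l"
  assumes "continuous_on S f" "continuous_on S g"
  shows "continuous_on S (\<lambda>x. cscale (f x) (g x))"
  unfolding cscale_def by (intro continuous_on_vec_lambda continuous_intros assms)

context jacobi_chain
begin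

definition "P z = a z N + cscale \<i> (c z N)"
definition "Q z = a z N - cscale \<i> (c z N)"
definition "R z = b z N + cscale \<i> (d z N)"
definition "S z = b z N - cscale \<i> (d z N)"

lemma P_inv: "Im z > 0 \<Longrightarrow> invertible (P z)"
  by (simp add: P_def invertible_plus_i)

lemma G_N_relation:
  assumes U: "unitary_mat U" and inv: "invertible (U - mat 1)" and z: "Im z > 0"
  shows "(P z - cadj U ** Q z) ** G_N N T V z U = R z - cadj U ** S z"
proof -
  let ?Z = "cayley_Z U" and ?G = "G_N N T V z U"
  have Z: "(U - mat 1) ** (?Z ** Y) = cscale \<i> (U ** Y + Y)" for Y
    by (simp add: matrix_mul_assoc cayley_Z_eq[OF U inv]) (simp add: matrix_ring_simps)
  have "(a z N + ?Z ** c z N) ** ?G = b z N + ?Z ** d z N"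
    unfolding G_N_eq using z by (intro block_inv_Hz cayley_Z_eq[OF U inv]) simp
  \<comment> \<open>The factor \<open>U - mat 1\<close> trades Z for i (U + 1), and
    \<open>cadj U\<close> leaves an expression affine in the adjoint of U.\<close>
  then have "cadj U ** ((U - mat 1) ** ((a z N + ?Z ** c z N) ** ?G)) = cadj U ** ((U - mat 1) ** (b z N + ?Z ** d z N))"
    by simp
  then have "cadj U ** ((U - mat 1) ** (a z N ** ?G)) + cadj U ** ((U - mat 1) ** (?Z ** (c z N ** ?G)))
      = cadj U ** ((U - mat 1) ** b z N) + cadj U ** ((U - mat 1) ** (?Z ** d z N))"
    by (simp only: matrix_plus_rdistrib matrix_add_ldistrib matrix_mul_assoc)
  then show ?thesis
    unfolding Z by (simp add: P_def Q_def R_def S_def matrix_ring_simps unitary_cancel[OF U] algebra_simps)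
qed

lemma invertible_P_minus:
  assumes "unitary_mat U" and "Im z > 0"
  shows "invertible (P z - cadj U ** Q z)"
proof (rule invertible_if_injective, rule ccontr)
  fix X :: "complex^'l^'l"
  assume "(P z - cadj U ** Q z) ** X = 0" and "X \<noteq> 0"
  then have "norm (P z ** X) = norm (cadj U ** (Q z ** X))"
    by (simp add: matrix_ring_simps)
  also have "\<dots> = norm (Q z ** X)"
    by (rule norm_unitary_mult[OF unitary_cadj[OF assms(1)]])
  also have "\<dots> < norm (P z ** X)"
    unfolding P_def Q_def by (rule norm_boundary_less[OF assms(2) \<open>X \<noteq> 0\<close>])
  finally show False
    by simp
qed

text \<open>On \<open>good\<close> the relation is solved by a continuous function of U; elsewhere
  \<open>cayley_Z\<close> is one fixed matrix, so the Green function is constant there.\<close>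

lemma G_N_measurable:
  assumes z: "Im z > 0"
  shows "G_N N T V z \<in> borel_measurable borel"
proof -
  define good where "good = {U :: complex^'l^'l. unitary_mat U} \<inter> {U. invertible (U - mat 1)}"
  define f where "f = (\<lambda>U. matrix_inv (P z - cadj U ** Q z) ** (R z - cadj U ** S z))"
  have "open {U :: complex^'l^'l. invertible (U - mat 1)}"
    using open_vimage[OF open_invertible, of "\<lambda>U :: complex^'l^'l. U - mat 1"]
    by (simp add: vimage_def continuous_intros)
  then have [measurable]: "good \<in> sets borel"
    unfolding good_def by (intro sets.Int borel_unitary borel_open)
  have "continuous_on good f"
    unfolding f_def
  proof (intro continuous_intros continuous_on_compose2[OF continuous_on_matrix_inv])
    show "(\<lambda>U. P z - cadj U ** Q z) ` good \<subseteq> {A. invertible A}"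
      using z by (auto simp: good_def invertible_P_minus)
  qed
  then have [measurable]: "(\<lambda>U. indicator good U *\<^sub>R f U) \<in> borel_measurable borel"
    by (intro borel_measurable_continuous_on_indicator) measurable
  have "G_N N T V z U = (if U \<in> good then indicator good U *\<^sub>R f U
      else block_inv N (Hz z (THE Z. False)) 1 1)" for U
  proof (cases "U \<in> good")
    case True
    then have "(P z - cadj U ** Q z) ** G_N N T V z U = R z - cadj U ** S z" "invertible (P z - cadj U ** Q z)"
      using z by (auto simp: good_def G_N_relation invertible_P_minus)
    then show ?thesis
      using True by (simp add: f_def matrix_eq_inv_mult_iff)
  next
    case False
    then have "\<not> (unitary_mat U \<and> invertible (U - mat 1))"
      by (simp add: good_def)
    then have "cayley_Z U = (THE Z. False)"
      by (rule cayley_Z_junk)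
    then show ?thesis
      using False by (simp add: G_N_eq)
  qed
  then have "G_N N T V z = (\<lambda>U. if U \<in> good then indicator good U *\<^sub>R f U
      else block_inv N (Hz z (THE Z. False)) 1 1)"
    by blast
  then show ?thesis
    by simp
qed

lemma haar_integral_G_N:
  assumes z: "Im z > 0"
  shows "integrable haar_unitary (G_N N T V z)"
    and "(LINT U|haar_unitary. G_N N T V z U) = matrix_inv (P z) ** R z"
proof -
  let ?G = "G_N N T V z"
  interpret prob_space "haar_unitary :: (complex^'l^'l) measure"
    by (rule prob_space_haar)
  define K where "K = Q z ** matrix_inv (P z)"
  \<comment> \<open>The relation says D = U^* (Q G - S), and Q G = K (D + R) closes the equation in
    D.\<close>
  define D where "D = (\<lambda>U. P z ** ?G U - R z)"
  have contr: "norm (K ** Y) < norm Y" if "Y \<noteq> 0" for Y :: "complex^'l^'l"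
  proof -
    define X where "X = matrix_inv (P z) ** Y"
    have PX: "P z ** X = Y"
      by (simp add: X_def matrix_mul_assoc matrix_inv_right[OF P_inv[OF z]])
    then have "X \<noteq> 0"
      using that by auto
    then have "norm (Q z ** X) < norm (P z ** X)"
      unfolding P_def Q_def by (rule norm_boundary_less[OF z])
    then show ?thesis
      unfolding PX by (simp add: K_def X_def matrix_mul_assoc)
  qed
  have G_meas [measurable]: "?G \<in> borel_measurable borel"
    by (rule G_N_measurable[OF z])
  have D_meas: "D \<in> borel_measurable borel"
    unfolding D_def by measurable
  have fixed: "AE U in haar_unitary. D U = cadj U ** ((K ** R z - S z) + K ** D U)"
    using AE_haar_unitary AE_haar_no_eigenvalue_1
  proof eventually_elim
    fix U :: "complex^'l^'l" assume U: "unitary_mat U" "invertible (U - mat 1)"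
    have "K ** (P z ** ?G U) = Q z ** ?G U"
      using matrix_inv_left[OF P_inv[OF z]]
      by (simp add: K_def) (metis matrix_mul_assoc matrix_mul_lid)
    moreover have "P z ** ?G U - cadj U ** (Q z ** ?G U) = R z - cadj U ** S z"
      using G_N_relation[OF U z] by (simp add: matrix_ring_simps)
    ultimately show "D U = cadj U ** ((K ** R z - S z) + K ** D U)"
      by (simp add: D_def matrix_ring_simps algebra_simps)
  qed
  note D = haar_integral_fixed_point[OF contr D_meas fixed]
  have G_D: "?G = (\<lambda>U. matrix_inv (P z) ** (D U + R z))"
    using matrix_inv_left[OF P_inv[OF z]] by (simp add: D_def matrix_mul_assoc fun_eq_iff)
  have bl: "bounded_linear (\<lambda>X. matrix_inv (P z) ** (X :: complex^'l^'l))"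
    by (rule bounded_bilinear.bounded_linear_right[OF bounded_bilinear_matrix_mult])
  have DR: "integrable haar_unitary (\<lambda>U. D U + R z)"
    using D(1) by simp
  show "integrable haar_unitary ?G"
    unfolding G_D by (rule integrable_bounded_linear[OF bl DR])
  have "(LINT U|haar_unitary. ?G U) = matrix_inv (P z) ** (LINT U|haar_unitary. D U + R z)"
    unfolding G_D by (rule integral_bounded_linear[OF bl DR])
  also have "(LINT U|haar_unitary. D U + R z) = R z"
    using D prob_space by simp
  finally show "(LINT U|haar_unitary. ?G U) = matrix_inv (P z) ** R z" .
qed

lemma inv_P_R_adjoint:
  assumes z: "Im z > 0"
  shows "matrix_inv (P z) ** R z = (cadj (b (cnj z) N) + cscale \<i> (cadj (d (cnj z) N)))
    ** matrix_inv (cadj (a (cnj z) N) + cscale \<i> (cadj (c (cnj z) N)))"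
    (is "_ = ?R ** matrix_inv ?P")
proof -
  have "?P = cadj (a (cnj z) N - cscale \<i> (c (cnj z) N))"
    by (simp add: cadj_simps cscale_neg)
  then have inv: "invertible ?P"
    using z by (simp add: invertible_cadj invertible_minus_i)
  note s = transfer_symplectic[OF order_refl, of z]
  \<comment> \<open>After cross-multiplication the difference sorts into the four symplectic
    relations: two vanish and the two equal to 1 cancel.\<close>
  have "R z ** ?P - P z ** ?R
      = (b z N ** cadj (a (cnj z) N) - a z N ** cadj (b (cnj z) N))
      - (d z N ** cadj (c (cnj z) N) - c z N ** cadj (d (cnj z) N))
      + cscale \<i> ((d z N ** cadj (a (cnj z) N) - c z N ** cadj (b (cnj z) N))
        - (a z N ** cadj (d (cnj z) N) - b z N ** cadj (c (cnj z) N)))"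
    by (simp add: P_def R_def matrix_ring_simps algebra_simps)
  then have "R z ** ?P = P z ** ?R"
    using s by (simp add: cscale_zero)
  then have "(matrix_inv (P z) ** R z) ** ?P = ?R"
    by (simp only: matrix_mul_assoc[symmetric]) (simp add: matrix_mul_assoc matrix_inv_left[OF P_inv[OF z]])
  then have "(matrix_inv (P z) ** R z) ** ?P ** matrix_inv ?P = ?R ** matrix_inv ?P"
    by simp
  then show ?thesis
    by (simp only: matrix_mul_assoc[symmetric] matrix_inv_right[OF inv] matrix_mul_rid)
qed

text \<open>For G = P^{-1} R the difference G - G^* is R P^* - P R^* placed between P^{-1} and its
  adjoint. The symplectic relations make the middle factor 2i, now with the two unit relations
  adding.\<close>

lemma mat_Im_inv_P_R_real:
  fixes E :: real
  defines "z \<equiv> complex_of_real E"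
  shows "mat_Im (matrix_inv (P z) ** R z) = matrix_inv (cadj (a z N) ** a z N + cadj (c z N) ** c z N)"
proof -
  have inv: "invertible (P z)"
    unfolding P_def z_def by (rule invertible_plus_i_real)
  have cnj: "cnj z = z"
    by (simp add: z_def)
  let ?Pi = "matrix_inv (P z)"
  have PP: "cadj (P z) ** P z = cadj (a z N) ** a z N + cadj (c z N) ** c z N"
    using transfer_cadj_a_c[OF order_refl, of z]
    by (simp add: P_def cadj_simps matrix_ring_simps cnj)
  have Pi: "?Pi ** P z = mat 1" "P z ** ?Pi = mat 1"
    using inv by (simp_all add: matrix_inv_left matrix_inv_right)
  have Pi_adj: "cadj (P z) ** cadj ?Pi = mat 1"
    by (simp add: cadj_mult[symmetric] Pi)
  have "(cadj (P z) ** P z) ** (?Pi ** cadj ?Pi) = mat 1"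
    using Pi(2) Pi_adj by (metis matrix_mul_assoc matrix_mul_rid)
  then have M: "matrix_inv (cadj (a z N) ** a z N + cadj (c z N) ** c z N) = ?Pi ** cadj ?Pi"
    unfolding PP by (rule matrix_inv_unique)
  note s = transfer_symplectic[OF order_refl, of z, unfolded cnj]
  have "R z ** cadj (P z) - P z ** cadj (R z)
      = (b z N ** cadj (a z N) - a z N ** cadj (b z N))
      + (d z N ** cadj (c z N) - c z N ** cadj (d z N))
      + cscale \<i> ((d z N ** cadj (a z N) - c z N ** cadj (b z N))
        + (a z N ** cadj (d z N) - b z N ** cadj (c z N)))"
    by (simp add: P_def R_def cadj_simps matrix_ring_simps algebra_simps)
  then have RP: "R z ** cadj (P z) - P z ** cadj (R z) = cscale (2 * \<i>) (mat 1)"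
    using s by (simp add: vec_eq_iff)
  have "?Pi ** R z - cadj (?Pi ** R z) = ?Pi ** (R z ** cadj (P z) - P z ** cadj (R z)) ** cadj ?Pi"
    by (simp add: cadj_mult matrix_ring_simps Pi_adj) (simp add: matrix_mul_assoc Pi)
  also have "\<dots> = cscale (2 * \<i>) (?Pi ** cadj ?Pi)"
    unfolding RP by (simp add: matrix_ring_simps)
  finally show ?thesis
    unfolding M mat_Im_eq by (simp add: cscale_cscale cscale_one)
qed

lemma continuous_on_transfer:
  "continuous_on UNIV (\<lambda>z. a z n) \<and> continuous_on UNIV (\<lambda>z. b z n) \<and>
   continuous_on UNIV (\<lambda>z. c z n) \<and> continuous_on UNIV (\<lambda>z. d z n)"
  by (induction n)
    (auto simp: transfer_0 transfer_Suc intro!: continuous_intros continuous_on_cscale_mult)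

text \<open>The closed form is continuous up to the real axis because P is invertible there as
  well.\<close>

lemma tendsto_mat_Im_inv_P_R:
  "((\<lambda>\<eta>. mat_Im (matrix_inv (P (Complex E \<eta>)) ** R (Complex E \<eta>)))
    \<longlongrightarrow> mat_Im (matrix_inv (P (complex_of_real E)) ** R (complex_of_real E))) (at_right 0)"
proof -
  have "((\<lambda>\<eta>. Complex E \<eta>) \<longlongrightarrow> Complex E 0) (at_right 0)"
    by (intro tendsto_Complex tendsto_const tendsto_ident_at)
  then have path: "((\<lambda>\<eta>. Complex E \<eta>) \<longlongrightarrow> complex_of_real E) (at_right 0)"
    by (simp add: complex_of_real_def)
  have lim: "((\<lambda>\<eta>. f (Complex E \<eta>)) \<longlongrightarrow> f (complex_of_real E)) (at_right 0)"
    if "continuous_on UNIV f" for f :: "complex \<Rightarrow> complex^'l^'l"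
    using continuous_on_tendsto_compose[OF that path] by simp
  have "continuous_on UNIV P" "continuous_on UNIV R"
    unfolding P_def[abs_def] R_def[abs_def]
    using continuous_on_transfer[of N] by (auto intro!: continuous_intros)
  then show ?thesis
    using invertible_plus_i_real[of E]
    by (intro bounded_linear.tendsto[OF bounded_linear_mat_Im] tendsto_intros tendsto_matrix_inv lim)
      (simp_all add: P_def)
qed

end

theorem theorem2:
  fixes N :: nat
    and T V :: "nat \<Rightarrow> complex^'l^'l"
  assumes N_pos: "N \<ge> 1"
    and T_inv: "\<And>n. n \<in> {2..N} \<Longrightarrow> invertible (T n)"
    and V_sa: "\<And>n. n \<in> {1..N} \<Longrightarrow> self_adjoint_mat (V n)"
  shows "(\<forall>z. Im z > 0 \<longrightarrow>
            integral\<^sup>L haar_unitary (\<lambda>U. G_N N T V z U)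
              = matrix_inv (A_N N T V z + mat \<i> ** C_N N T V z) ** (B_N N T V z + mat \<i> ** D_N N T V z)
          \<and> integral\<^sup>L haar_unitary (\<lambda>U. G_N N T V z U)
              = (cadj (B_N N T V (cnj z)) + mat \<i> ** cadj (D_N N T V (cnj z)))
                ** matrix_inv (cadj (A_N N T V (cnj z)) + mat \<i> ** cadj (C_N N T V (cnj z))))
       \<and> (\<forall>E::real.
            ((\<lambda>\<eta>. integral\<^sup>L haar_unitary (\<lambda>U. mat_Im (G_N N T V (Complex E \<eta>) U)))
              \<longlongrightarrow> matrix_inv (cadj (A_N N T V (complex_of_real E)) ** A_N N T V (complex_of_real E)
                               + cadj (C_N N T V (complex_of_real E)) ** C_N N T V (complex_of_real E)))
            (at_right 0))"
proof -
  interpret jacobi_chain N T V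
    by unfold_locales (fact N_pos T_inv V_sa)+
  have abcd: "A_N N T V z = a z N" "B_N N T V z = b z N" "C_N N T V z = c z N" "D_N N T V z = d z N" for z
    by (simp_all add: A_N_def B_N_def C_N_def D_N_def a_def b_def c_def d_def)
  show ?thesis
    unfolding abcd mat_mult_eq_cscale P_def[symmetric] R_def[symmetric]
  proof (intro conjI allI impI)
    fix z :: complex assume z: "Im z > 0"
    show "(LINT U|haar_unitary. G_N N T V z U) = matrix_inv (P z) ** R z"
      by (rule haar_integral_G_N[OF z])
    then show "(LINT U|haar_unitary. G_N N T V z U) = (cadj (b (cnj z) N) + cscale \<i> (cadj (d (cnj z) N)))
        ** matrix_inv (cadj (a (cnj z) N) + cscale \<i> (cadj (c (cnj z) N)))"
      by (simp only: inv_P_R_adjoint[OF z])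
  next
    fix E :: real
    have "(LINT U|haar_unitary. mat_Im (G_N N T V z U)) = mat_Im (matrix_inv (P z) ** R z)" if "Im z > 0" for z
      using integral_bounded_linear[OF bounded_linear_mat_Im haar_integral_G_N(1)[OF that]]
      by (simp only: haar_integral_G_N(2)[OF that])
    then have "\<forall>\<^sub>F \<eta> in at_right 0. mat_Im (matrix_inv (P (Complex E \<eta>)) ** R (Complex E \<eta>))
        = (LINT U|haar_unitary. mat_Im (G_N N T V (Complex E \<eta>) U))"
      using eventually_at_right_less[of 0] by (auto elim!: eventually_mono)
    then show "((\<lambda>\<eta>. LINT U|haar_unitary. mat_Im (G_N N T V (Complex E \<eta>) U))
        \<longlongrightarrow> matrix_inv (cadj (a (of_real E) N) ** a (of_real E) N + cadj (c (of_real E) N) ** c (of_real E) N))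
        (at_right 0)"
      using tendsto_mat_Im_inv_P_R[of E] unfolding mat_Im_inv_P_R_real
      by (rule Lim_transform_eventually[rotated])
  qed
qed

end
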